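(* If $\mathbb{X}$ is a set of $s>1$ points in generic position in $\mathbb{P}^{n_1}\times\cdots\times\mathbb{P}^{n_k}$, then $\operatorname{depth}R/I_{\mathbb{X}}=1$. In particular, $R/I_{\mathbb{X}}$ is Cohen-Macaulay if and only if $k=1$.
   Context: $\mathbf{k}$ is an algebraically closed field of characteristic $0$; $\mathbb{N}=\{0,1,2,\ldots\}$; $k\ge 1$ and $n_1,\ldots,n_k\ge 1$ are integers; $e_1,\ldots,e_k$ is the standard basis of $\mathbb{N}^k$. $R=\mathbf{k}[x_{l,m} : 1\le l\le k,\ 0\le m\le n_l]$ is $\mathbb{N}^k$-graded by $\deg x_{l,m}=e_l$; it is the coordinate ring of $\mathbb{P}^{n_1}\times\cdots\times\mathbb{P}^{n_k}$ over $\mathbf{k}$. $N(\underline{j})=\dim_{\mathbf{k}}R_{\underline{j}}=\prod_{l=1}^k\binom{n_l+j_l}{j_l}$. For a nonempty finite set $\mathbb{X}$ of points, $I_{\mathbb{X}}\subseteq R$ is the ideal generated by the $\mathbb{N}^k$-homogeneous forms vanishing at every point of $\mathbb{X}$, and $H_{\mathbb{X}}(\underline{j})=\dim_{\mathbf{k}}(R/I_{\mathbb{X}})_{\underline{j}}$. A set $\mathbb{X}$ of $s$ (distinct) points is in generic position if $H_{\mathbb{X}}(\underline{j})=\min\{N(\underline{j}),s\}$ for all $\underline{j}\in\mathbb{N}^k$. Depth is taken with respect to the ideal generated by all the variables $x_{l,m}$. *)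

theory Defs
  imports "HOL-Algebra.Algebra" "HOL-Computational_Algebra.Polynomial"
    "HOL-Library.Poly_Mapping" "HOL-Library.Extended_Nat"
begin

section \<open>Depth, Krull dimension and Cohen-Macaulayness\<close>

text \<open>
  \<open>f\<^sub>i\<close> is a nonzerodivisor on the quotient of \<open>A\<close> by the ideal generated by its predecessors
  (the condition is written out in \<open>A\<close> rather than in the iterated quotient), and
  the whole sequence generates a proper ideal.
\<close>
definition regular_sequence :: "('a, 'b) ring_scheme \<Rightarrow> 'a list \<Rightarrow> bool" where
  "regular_sequence A fs \<longleftrightarrow>
     set fs \<subseteq> carrier A \<and>
     (\<forall>i<length fs. \<forall>a\<in>carrier A.
        fs ! i \<otimes>\<^bsub>A\<^esub> a \<in> Idl\<^bsub>A\<^esub> (set (take i fs)) \<longrightarrow> a \<in> Idl\<^bsub>A\<^esub> (set (take i fs))) \<and>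
     Idl\<^bsub>A\<^esub> (set fs) \<noteq> carrier A"

definition depth :: "('a, 'b) ring_scheme \<Rightarrow> 'a set \<Rightarrow> enat" where
  "depth A J = Sup {enat (length fs) | fs. set fs \<subseteq> J \<and> regular_sequence A fs}"

definition krull_dim :: "('a, 'b) ring_scheme \<Rightarrow> enat" where
  "krull_dim A = Sup {enat r | r. \<exists>P :: nat \<Rightarrow> 'a set.
     (\<forall>i\<le>r. primeideal (P i) A) \<and> (\<forall>i<r. P i \<subset> P (Suc i))}"

text \<open>
  The graded notion: \<open>J\<close> stands for the irrelevant ideal of a graded algebra \<open>A\<close> over a field,
  and \<open>A\<close> is Cohen-Macaulay if its depth with respect to \<open>J\<close> attains its Krull dimension.
\<close>
definition cohen_macaulay :: "('a, 'b) ring_scheme \<Rightarrow> 'a set \<Rightarrow> bool" where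
  "cohen_macaulay A J \<longleftrightarrow> depth A J = krull_dim A"

section \<open>The multigraded polynomial ring\<close>

text \<open>
  A monomial is an exponent function with finite support; the pair \<open>(l, m)\<close> is the index of the
  variable \<open>x\<^sub>l\<^sub>,\<^sub>m\<close>.
\<close>
type_synonym monom = "(nat \<times> nat) \<Rightarrow>\<^sub>0 nat"
type_synonym 'a mpoly = "monom \<Rightarrow>\<^sub>0 'a"

definition var_indices :: "nat \<Rightarrow> (nat \<Rightarrow> nat) \<Rightarrow> (nat \<times> nat) set" where
  "var_indices k n = (SIGMA l:{1..k}. {0..n l})"

definition mpoly_ring :: "nat \<Rightarrow> (nat \<Rightarrow> nat) \<Rightarrow> 'a::field mpoly ring" where
  "mpoly_ring k n =
     \<lparr> carrier = {F. \<forall>t\<in>Poly_Mapping.keys F. Poly_Mapping.keys t \<subseteq> var_indices k n},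
       monoid.mult = (*), one = 1, ring.zero = 0, add = (+) \<rparr>"

definition Var :: "nat \<times> nat \<Rightarrow> 'a::field mpoly" where
  "Var v = Poly_Mapping.single (Poly_Mapping.single v 1) 1"

definition Const :: "'a::field \<Rightarrow> 'a mpoly" where
  "Const c = Poly_Mapping.single 0 c"

definition eval_mpoly :: "(nat \<times> nat \<Rightarrow> 'a::field) \<Rightarrow> 'a mpoly \<Rightarrow> 'a" where
  "eval_mpoly a F = (\<Sum>t\<in>Poly_Mapping.keys F.
     Poly_Mapping.lookup F t * (\<Prod>v\<in>Poly_Mapping.keys t. a v ^ Poly_Mapping.lookup t v))"

text \<open>
  The graded piece of multidegree \<open>(j 1, \<dots>, j k)\<close>, including \<open>0\<close>. Multidegrees are functions
  on \<open>nat\<close> of which only the values on \<open>{1..k}\<close> matter.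
\<close>
definition forms :: "nat \<Rightarrow> (nat \<Rightarrow> nat) \<Rightarrow> (nat \<Rightarrow> nat) \<Rightarrow> 'a::field mpoly set" where
  "forms k n j = {F \<in> carrier (mpoly_ring k n).
     \<forall>t\<in>Poly_Mapping.keys F. \<forall>l\<in>{1..k}. (\<Sum>m=0..n l. Poly_Mapping.lookup t (l, m)) = j l}"

lemma cring_mpoly_ring: "cring (mpoly_ring k n :: 'a::field mpoly ring)"
proof -
  have neg: "\<exists>G. (\<forall>t\<in>Poly_Mapping.keys G. Poly_Mapping.keys t \<subseteq> var_indices k n) \<and> F + G = 0"
    if "\<forall>t\<in>Poly_Mapping.keys F. Poly_Mapping.keys t \<subseteq> var_indices k n" for F :: "'a mpoly"
    using that by (intro exI[of _ "- F"]) auto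
  have add: "Poly_Mapping.keys t \<subseteq> var_indices k n"
    if "\<forall>t\<in>Poly_Mapping.keys F. Poly_Mapping.keys t \<subseteq> var_indices k n"
       "\<forall>t\<in>Poly_Mapping.keys G. Poly_Mapping.keys t \<subseteq> var_indices k n"
       "t \<in> Poly_Mapping.keys (F + G)" for F G :: "'a mpoly" and t
    using that Poly_Mapping.keys_add[of F G] by blast
  have mult: "Poly_Mapping.keys t \<subseteq> var_indices k n"
    if a: "\<forall>t\<in>Poly_Mapping.keys F. Poly_Mapping.keys t \<subseteq> var_indices k n"
       "\<forall>t\<in>Poly_Mapping.keys G. Poly_Mapping.keys t \<subseteq> var_indices k n"
       "t \<in> Poly_Mapping.keys (F * G)" for F G :: "'a mpoly" and t
  proof -
    obtain a b where "t = a + b" "a \<in> Poly_Mapping.keys F" "b \<in> Poly_Mapping.keys G"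
      using a(3) Poly_Mapping.keys_mult[of F G] by blast
    thus ?thesis using a(1,2) Poly_Mapping.keys_add[of a b] by blast
  qed
  show ?thesis
  proof (rule cringI)
    show "abelian_group (mpoly_ring k n :: 'a mpoly ring)"
    proof (rule abelian_groupI)
      fix F :: "'a mpoly" assume "F \<in> carrier (mpoly_ring k n)"
      thus "\<exists>G\<in>carrier (mpoly_ring k n). G \<oplus>\<^bsub>mpoly_ring k n\<^esub> F = \<zero>\<^bsub>mpoly_ring k n\<^esub>"
        using neg[of F] by (auto simp: mpoly_ring_def add.commute)
    qed (auto simp: mpoly_ring_def add_ac dest: add)
    show "comm_monoid (mpoly_ring k n :: 'a mpoly ring)"
      by (rule comm_monoidI) (auto simp: mpoly_ring_def mult_ac dest: mult)
  qed (auto simp: mpoly_ring_def algebra_simps)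
qed

section \<open>Points in a product of projective spaces\<close>

definition nonzero_vecs :: "nat \<Rightarrow> (nat \<Rightarrow> 'a::field) set" where
  "nonzero_vecs n = {v. (\<forall>m>n. v m = 0) \<and> (\<exists>m\<le>n. v m \<noteq> 0)}"

definition proportional :: "nat \<Rightarrow> ((nat \<Rightarrow> 'a::field) \<times> (nat \<Rightarrow> 'a)) set" where
  "proportional n = {(u, v). u \<in> nonzero_vecs n \<and> v \<in> nonzero_vecs n \<and>
     (\<exists>c. c \<noteq> 0 \<and> v = (\<lambda>m. c * u m))}"

definition proj_space :: "nat \<Rightarrow> (nat \<Rightarrow> 'a::field) set set" where
  "proj_space n = nonzero_vecs n // proportional n"

lemma equiv_proportional: "equiv (nonzero_vecs n) (proportional n :: ((nat \<Rightarrow> 'a::field) \<times> _) set)"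
proof (rule equivI)
  show "proportional n \<subseteq> nonzero_vecs n \<times> nonzero_vecs n"
    by (auto simp: proportional_def)
  show "refl_on (nonzero_vecs n) (proportional n :: ((nat \<Rightarrow> 'a) \<times> _) set)"
    by (auto simp: refl_on_def proportional_def intro: exI[of _ 1])
  show "sym (proportional n :: ((nat \<Rightarrow> 'a) \<times> _) set)"
  proof (rule symI)
    fix u v :: "nat \<Rightarrow> 'a" assume "(u, v) \<in> proportional n"
    then obtain c where "u \<in> nonzero_vecs n" "v \<in> nonzero_vecs n" "c \<noteq> 0" "v = (\<lambda>m. c * u m)"
      by (auto simp: proportional_def)
    thus "(v, u) \<in> proportional n"
      by (auto simp: proportional_def intro!: exI[of _ "inverse c"])
  qed
  show "trans (proportional n :: ((nat \<Rightarrow> 'a) \<times> _) set)"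
  proof (rule transI)
    fix u v w :: "nat \<Rightarrow> 'a" assume "(u, v) \<in> proportional n" "(v, w) \<in> proportional n"
    then obtain c d where "u \<in> nonzero_vecs n" "w \<in> nonzero_vecs n" "c \<noteq> 0" "d \<noteq> 0"
      "v = (\<lambda>m. c * u m)" "w = (\<lambda>m. d * v m)" by (auto simp: proportional_def)
    thus "(u, w) \<in> proportional n"
      by (auto simp: proportional_def intro!: exI[of _ "d * c"])
  qed
qed

definition multiproj_space :: "nat \<Rightarrow> (nat \<Rightarrow> nat) \<Rightarrow> (nat \<Rightarrow> (nat \<Rightarrow> 'a::field) set) set" where
  "multiproj_space k n = (\<Pi>\<^sub>E l\<in>{1..k}. proj_space (n l))"

text \<open>Vanishing on all representatives; for forms one representative would suffice.\<close>
definition vanishes_at :: "nat \<Rightarrow> 'a::field mpoly \<Rightarrow> (nat \<Rightarrow> (nat \<Rightarrow> 'a) set) \<Rightarrow> bool" where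
  "vanishes_at k F P \<longleftrightarrow>
     (\<forall>v. (\<forall>l\<in>{1..k}. v l \<in> P l) \<longrightarrow> eval_mpoly (\<lambda>(l, m). v l m) F = 0)"

section \<open>The coordinate ring of a set of points\<close>

definition points_ideal ::
    "nat \<Rightarrow> (nat \<Rightarrow> nat) \<Rightarrow> (nat \<Rightarrow> (nat \<Rightarrow> 'a::field) set) set \<Rightarrow> 'a mpoly set" where
  "points_ideal k n \<XX> = Idl\<^bsub>mpoly_ring k n\<^esub> {F. \<exists>j. F \<in> forms k n j \<and> (\<forall>P\<in>\<XX>. vanishes_at k F P)}"

definition coord_ring ::
    "nat \<Rightarrow> (nat \<Rightarrow> nat) \<Rightarrow> (nat \<Rightarrow> (nat \<Rightarrow> 'a::field) set) set \<Rightarrow> 'a mpoly set ring" where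
  "coord_ring k n \<XX> = mpoly_ring k n Quot points_ideal k n \<XX>"

definition residue_class ::
    "nat \<Rightarrow> (nat \<Rightarrow> nat) \<Rightarrow> (nat \<Rightarrow> (nat \<Rightarrow> 'a::field) set) set \<Rightarrow> 'a mpoly \<Rightarrow> 'a mpoly set" where
  "residue_class k n \<XX> F = points_ideal k n \<XX> +>\<^bsub>mpoly_ring k n\<^esub> F"

definition irrelevant_ideal ::
    "nat \<Rightarrow> (nat \<Rightarrow> nat) \<Rightarrow> (nat \<Rightarrow> (nat \<Rightarrow> 'a::field) set) set \<Rightarrow> 'a mpoly set set" where
  "irrelevant_ideal k n \<XX> =
     Idl\<^bsub>coord_ring k n \<XX>\<^esub> (residue_class k n \<XX> ` Var ` var_indices k n)"

text \<open>
  The graded piece of the quotient is the image of the graded piece of the polynomial ring, and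
  its dimension is taken over the copy of the ground field formed by the residue classes of
  constants.
\<close>
definition hilbert_function ::
    "nat \<Rightarrow> (nat \<Rightarrow> nat) \<Rightarrow> (nat \<Rightarrow> (nat \<Rightarrow> 'a::field) set) set \<Rightarrow> (nat \<Rightarrow> nat) \<Rightarrow> nat" where
  "hilbert_function k n \<XX> j =
     ring.dim (coord_ring k n \<XX>)
       (residue_class k n \<XX> ` range Const)
       (residue_class k n \<XX> ` forms k n j)"

text \<open>The dimension of the space of all forms of multidegree \<open>j\<close>.\<close>
definition num_monoms :: "nat \<Rightarrow> (nat \<Rightarrow> nat) \<Rightarrow> (nat \<Rightarrow> nat) \<Rightarrow> nat" where
  "num_monoms k n j = (\<Prod>l=1..k. (n l + j l) choose j l)"

definition generic_position ::
    "nat \<Rightarrow> (nat \<Rightarrow> nat) \<Rightarrow> (nat \<Rightarrow> (nat \<Rightarrow> 'a::field) set) set \<Rightarrow> bool" where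
  "generic_position k n \<XX> \<longleftrightarrow>
     (\<forall>j. hilbert_function k n \<XX> j = min (num_monoms k n j) (card \<XX>))"

end

theory Submission
  imports Defs
begin

text \<open>
  A polynomial lies in the ideal of the points iff it vanishes on the cones over all the points,
  because vanishing on a cone passes to multihomogeneous components. Hence a linear form \<open>L\<close> of
  degree \<open>e\<^sub>1\<close> that vanishes at no point is a nonzerodivisor on \<open>A = R/I\<close>. Choose a multidegree
  \<open>i\<close> with \<open>N(i) < s\<close> and \<open>s \<le> N(i + e\<^sub>l)\<close> for all \<open>l\<close>. The Hilbert function takes the value
  \<open>N(i) < s\<close> at \<open>i\<close> and the value \<open>s\<close> at \<open>i + e\<^sub>l\<close> and \<open>i + e\<^sub>1 + e\<^sub>l\<close>, so
  \<open>L A\<^sub>i \<noteq> A\<^bsub>i + e\<^sub>1\<^esub>\<close>, whereas multiplication by \<open>L\<close> is onto \<open>A\<^bsub>i + e\<^sub>1 + e\<^sub>l\<^esub>\<close>. Any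
  \<open>g \<in> A\<^bsub>i + e\<^sub>1\<^esub> - L A\<^sub>i\<close> is therefore a nonzero element of \<open>A/LA\<close> killed by all
  variables, which forces the depth to be \<open>1\<close>. The Krull dimension is at least \<open>k\<close>, by the flag of
  coordinate subspaces of the cone over one point, and it is \<open>1\<close> for \<open>k = 1\<close>.
\<close>

section \<open>Evaluation of polynomials\<close>

text \<open>Extra monomials have coefficient 0, so polynomials with different supports can be summed
  over one common index set.\<close>

lemma eval_mpoly_superset:
  assumes "finite S" "Poly_Mapping.keys F \<subseteq> S"
  shows "eval_mpoly a F = (\<Sum>t\<in>S. Poly_Mapping.lookup F t *
    (\<Prod>v\<in>Poly_Mapping.keys t. a v ^ Poly_Mapping.lookup t v))"
  unfolding eval_mpoly_def using assms
  by (intro sum.mono_neutral_left) (auto simp: in_keys_iff)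

lemma eval_mpoly_zero [simp]: "eval_mpoly a 0 = 0"
  by (simp add: eval_mpoly_def)

lemma eval_mpoly_add: "eval_mpoly a (F + G) = eval_mpoly a F + eval_mpoly a G"
proof -
  define S where "S = Poly_Mapping.keys F \<union> Poly_Mapping.keys G"
  have "finite S" "Poly_Mapping.keys F \<subseteq> S" "Poly_Mapping.keys G \<subseteq> S"
    "Poly_Mapping.keys (F + G) \<subseteq> S"
    using Poly_Mapping.keys_add[of F G] by (auto simp: S_def)
  thus ?thesis
    by (simp add: eval_mpoly_superset[of S] lookup_add algebra_simps sum.distrib)
qed

lemma eval_mpoly_uminus: "eval_mpoly a (- F) = - eval_mpoly a F"
  using eval_mpoly_add[of a F "- F"] by (simp add: eq_neg_iff_add_eq_0 add.commute)

lemma eval_mpoly_diff: "eval_mpoly a (F - G) = eval_mpoly a F - eval_mpoly a G"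
  using eval_mpoly_add[of a F "- G"] by (simp add: eval_mpoly_uminus)

lemma eval_mpoly_sum: "eval_mpoly a (\<Sum>i\<in>S. f i) = (\<Sum>i\<in>S. eval_mpoly a (f i))"
  by (induction S rule: infinite_finite_induct) (auto simp: eval_mpoly_add)

lemma eval_mpoly_single:
  "eval_mpoly a (Poly_Mapping.single t c) =
    c * (\<Prod>v\<in>Poly_Mapping.keys t. a v ^ Poly_Mapping.lookup t v)"
  by (cases "c = 0") (auto simp: eval_mpoly_def)

lemma eval_monom_superset:
  fixes a :: "nat \<times> nat \<Rightarrow> 'a::field"
  assumes "finite S" "Poly_Mapping.keys t \<subseteq> S"
  shows "(\<Prod>v\<in>Poly_Mapping.keys t. a v ^ Poly_Mapping.lookup t v) =
    (\<Prod>v\<in>S. a v ^ Poly_Mapping.lookup t v)"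
  using assms by (intro prod.mono_neutral_left) (auto simp: in_keys_iff)

lemma eval_monom_add:
  fixes a :: "nat \<times> nat \<Rightarrow> 'a::field"
  shows "(\<Prod>v\<in>Poly_Mapping.keys (s + t). a v ^ Poly_Mapping.lookup (s + t) v) =
    (\<Prod>v\<in>Poly_Mapping.keys s. a v ^ Poly_Mapping.lookup s v) *
    (\<Prod>v\<in>Poly_Mapping.keys t. a v ^ Poly_Mapping.lookup t v)"
proof -
  define S where "S = Poly_Mapping.keys s \<union> Poly_Mapping.keys t"
  have "finite S" "Poly_Mapping.keys s \<subseteq> S" "Poly_Mapping.keys t \<subseteq> S"
    "Poly_Mapping.keys (s + t) \<subseteq> S"
    using Poly_Mapping.keys_add[of s t] by (auto simp: S_def)
  thus ?thesis
    unfolding eval_monom_superset[OF \<open>finite S\<close> \<open>Poly_Mapping.keys (s + t) \<subseteq> S\<close>]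
    by (simp add: eval_monom_superset[of S] lookup_add power_add prod.distrib)
qed

lemma mpoly_sum_single:
  "F = (\<Sum>t\<in>Poly_Mapping.keys F. Poly_Mapping.single t (Poly_Mapping.lookup F t))"
  by (rule poly_mapping_eqI) (auto simp: lookup_sum lookup_single when_def in_keys_iff)

lemma eval_mpoly_mult: "eval_mpoly a (F * G) = eval_mpoly a F * eval_mpoly a G"
proof -
  have "eval_mpoly a (F * G) =
    eval_mpoly a ((\<Sum>s\<in>Poly_Mapping.keys F. Poly_Mapping.single s (Poly_Mapping.lookup F s)) *
      (\<Sum>t\<in>Poly_Mapping.keys G. Poly_Mapping.single t (Poly_Mapping.lookup G t)))"
    using mpoly_sum_single[of F] mpoly_sum_single[of G] by simp
  also have "\<dots> = eval_mpoly a F * eval_mpoly a G"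
    unfolding sum_product mult_single eval_mpoly_sum eval_mpoly_single eval_monom_add
    by (simp add: eval_mpoly_def sum_product mult_ac)
  finally show ?thesis .
qed

lemma eval_mpoly_Const [simp]: "eval_mpoly a (Const c) = c"
  by (simp add: Const_def eval_mpoly_single)

lemma eval_mpoly_one [simp]: "eval_mpoly a 1 = 1"
  using eval_mpoly_single[of a 0 1] by simp

lemma eval_mpoly_Var [simp]: "eval_mpoly a (Var v) = a v"
  by (simp add: Var_def eval_mpoly_single)

lemma eval_mpoly_prod: "eval_mpoly a (\<Prod>i\<in>S. f i) = (\<Prod>i\<in>S. eval_mpoly a (f i))"
  by (induction S rule: infinite_finite_induct) (auto simp: eval_mpoly_mult)

text \<open>Substituting linear polynomials in one variable for all the \<open>v\<close> restricts
  \<open>F\<close> to a line. Density, vanishing and primality are all reduced to univariate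
  polynomials in this way.\<close>

lemma eval_mpoly_line:
  fixes a b :: "nat \<times> nat \<Rightarrow> 'a::field"
  shows "\<exists>p. \<forall>x. poly p x = eval_mpoly (\<lambda>v. a v + x * b v) F"
proof
  show "\<forall>x. poly (\<Sum>t\<in>Poly_Mapping.keys F. Polynomial.smult (Poly_Mapping.lookup F t)
      (\<Prod>v\<in>Poly_Mapping.keys t. [:a v, b v:] ^ Poly_Mapping.lookup t v)) x =
    eval_mpoly (\<lambda>v. a v + x * b v) F"
    by (simp add: eval_mpoly_def poly_sum poly_prod)
qed

section \<open>Polynomials in the variables of the coordinate ring\<close>

lemma mpoly_ring_simps [simp]:
  "monoid.mult (mpoly_ring k n) = (*)" "one (mpoly_ring k n) = 1"
  "ring.zero (mpoly_ring k n) = 0" "add (mpoly_ring k n) = (+)"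
  by (simp_all add: mpoly_ring_def)

lemma finite_var_indices [simp]: "finite (var_indices k n)"
  by (simp add: var_indices_def)

lemma mem_mpoly_ring:
  "F \<in> carrier (mpoly_ring k n) \<longleftrightarrow>
    (\<forall>t\<in>Poly_Mapping.keys F. Poly_Mapping.keys t \<subseteq> var_indices k n)"
  by (simp add: mpoly_ring_def)

lemma uminus_mem_mpoly_ring:
  "F \<in> carrier (mpoly_ring k n) \<Longrightarrow> - F \<in> carrier (mpoly_ring k n)"
  by (simp add: mem_mpoly_ring in_keys_iff)

lemma add_mem_mpoly_ring:
  "F \<in> carrier (mpoly_ring k n) \<Longrightarrow> G \<in> carrier (mpoly_ring k n) \<Longrightarrow>
    F + G \<in> carrier (mpoly_ring k n)"
  using ring.ring_simprules(1)[OF cring.axioms(1)[OF cring_mpoly_ring], of F k n G] by simp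

lemma diff_mem_mpoly_ring:
  "F \<in> carrier (mpoly_ring k n) \<Longrightarrow> G \<in> carrier (mpoly_ring k n) \<Longrightarrow>
    F - G \<in> carrier (mpoly_ring k n)"
  using add_mem_mpoly_ring[of F k n "- G"] by (simp add: uminus_mem_mpoly_ring)

lemma mult_mem_mpoly_ring:
  "F \<in> carrier (mpoly_ring k n) \<Longrightarrow> G \<in> carrier (mpoly_ring k n) \<Longrightarrow>
    F * G \<in> carrier (mpoly_ring k n)"
  using ring.ring_simprules(5)[OF cring.axioms(1)[OF cring_mpoly_ring], of F k n G] by simp

lemma zero_mem_mpoly_ring: "0 \<in> carrier (mpoly_ring k n)"
  by (simp add: mem_mpoly_ring)

lemma one_mem_mpoly_ring: "1 \<in> carrier (mpoly_ring k n)"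
  by (simp add: mem_mpoly_ring)

lemma Const_mem_mpoly_ring: "Const c \<in> carrier (mpoly_ring k n)"
  by (simp add: mem_mpoly_ring Const_def)

lemma Var_mem_mpoly_ring: "v \<in> var_indices k n \<Longrightarrow> Var v \<in> carrier (mpoly_ring k n)"
  by (simp add: mem_mpoly_ring Var_def)

lemma sum_mem_mpoly_ring:
  "(\<And>i. i \<in> S \<Longrightarrow> f i \<in> carrier (mpoly_ring k n)) \<Longrightarrow> (\<Sum>i\<in>S. f i) \<in> carrier (mpoly_ring k n)"
  by (induction S rule: infinite_finite_induct) (auto simp: add_mem_mpoly_ring zero_mem_mpoly_ring)

lemma prod_mem_mpoly_ring:
  "(\<And>i. i \<in> S \<Longrightarrow> f i \<in> carrier (mpoly_ring k n)) \<Longrightarrow> (\<Prod>i\<in>S. f i) \<in> carrier (mpoly_ring k n)"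
  by (induction S rule: infinite_finite_induct) (auto simp: mult_mem_mpoly_ring one_mem_mpoly_ring)

lemmas mpoly_ring_closed = uminus_mem_mpoly_ring add_mem_mpoly_ring diff_mem_mpoly_ring
  mult_mem_mpoly_ring zero_mem_mpoly_ring one_mem_mpoly_ring Const_mem_mpoly_ring
  Var_mem_mpoly_ring sum_mem_mpoly_ring prod_mem_mpoly_ring

lemma minus_mpoly_ring:
  assumes "F \<in> carrier (mpoly_ring k n)" "G \<in> carrier (mpoly_ring k n)"
  shows "F \<ominus>\<^bsub>mpoly_ring k n\<^esub> G = F - G"
proof -
  interpret cring "mpoly_ring k n :: 'a mpoly ring" by (rule cring_mpoly_ring)
  have "\<ominus>\<^bsub>mpoly_ring k n\<^esub> G = - G"
    using assms by (intro minus_equality) (auto simp: mpoly_ring_closed)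
  thus ?thesis by (simp add: a_minus_def)
qed

lemma eval_mpoly_cong:
  assumes "F \<in> carrier (mpoly_ring k n)" "\<And>v. v \<in> var_indices k n \<Longrightarrow> a v = b v"
  shows "eval_mpoly a F = eval_mpoly b F"
proof -
  have "a v = b v" if "t \<in> Poly_Mapping.keys F" "v \<in> Poly_Mapping.keys t" for t v
    using assms that unfolding mem_mpoly_ring by blast
  thus ?thesis by (auto simp: eval_mpoly_def intro!: sum.cong prod.cong)
qed

section \<open>Homogeneous components\<close>

definition multideg :: "(nat \<Rightarrow> nat) \<Rightarrow> monom \<Rightarrow> nat \<Rightarrow> nat" where
  "multideg n t l = (\<Sum>m=0..n l. Poly_Mapping.lookup t (l, m))"

lemma multideg_add: "multideg n (s + t) l = multideg n s l + multideg n t l"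
  by (simp add: multideg_def lookup_add sum.distrib)

lemma mem_forms:
  "F \<in> forms k n j \<longleftrightarrow> F \<in> carrier (mpoly_ring k n) \<and>
    (\<forall>t\<in>Poly_Mapping.keys F. \<forall>l\<in>{1..k}. multideg n t l = j l)"
  by (simp add: forms_def multideg_def)

lemma forms_in_mpoly_ring: "F \<in> forms k n j \<Longrightarrow> F \<in> carrier (mpoly_ring k n)"
  by (simp add: mem_forms)

lemma forms_mult:
  assumes "F \<in> forms k n i" "G \<in> forms k n j"
  shows "F * G \<in> forms k n (\<lambda>l. i l + j l)"
proof -
  have "multideg n t l = i l + j l" if t: "t \<in> Poly_Mapping.keys (F * G)" and l: "l \<in> {1..k}" for t l
  proof -
    obtain a b where "t = a + b" "a \<in> Poly_Mapping.keys F" "b \<in> Poly_Mapping.keys G"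
      using t Poly_Mapping.keys_mult[of F G] by blast
    thus ?thesis using assms l by (auto simp: mem_forms multideg_add)
  qed
  thus ?thesis using assms by (auto simp: mem_forms mpoly_ring_closed)
qed

lemma forms_add: "F \<in> forms k n j \<Longrightarrow> G \<in> forms k n j \<Longrightarrow> F + G \<in> forms k n j"
  using Poly_Mapping.keys_add[of F G] by (fastforce simp: mem_forms mpoly_ring_closed)

lemma forms_uminus: "F \<in> forms k n j \<Longrightarrow> - F \<in> forms k n j"
  by (auto simp: mem_forms mpoly_ring_closed in_keys_iff)

lemma forms_zero: "0 \<in> forms k n j"
  by (simp add: mem_forms mpoly_ring_closed)

lemma forms_sum: "(\<And>i. i \<in> S \<Longrightarrow> f i \<in> forms k n j) \<Longrightarrow> (\<Sum>i\<in>S. f i) \<in> forms k n j"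
  by (induction S rule: infinite_finite_induct) (auto simp: forms_add forms_zero)

lemma Const_mem_forms: "Const c \<in> forms k n (\<lambda>_. 0)"
  by (auto simp: mem_forms mem_mpoly_ring Const_def multideg_def)

lemma Const_mult_forms: "F \<in> forms k n j \<Longrightarrow> Const c * F \<in> forms k n j"
  using forms_mult[OF Const_mem_forms] by simp

lemma Var_mem_forms:
  assumes "(l, m) \<in> var_indices k n"
  shows "(Var (l, m) :: 'a::field mpoly) \<in> forms k n (\<lambda>l'. of_bool (l' = l))"
proof -
  have "multideg n (Poly_Mapping.single (l, m) 1) l' = of_bool (l' = l)" for l'
    using assms by (auto simp: multideg_def var_indices_def lookup_single when_def)
  moreover have "Poly_Mapping.keys (Var (l, m) :: 'a mpoly) = {Poly_Mapping.single (l, m) 1}"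
    by (simp add: Var_def)
  ultimately show ?thesis using assms by (simp add: mem_forms mpoly_ring_closed)
qed

text \<open>An arbitrary predicate, rather than a multidegree, allows the degree to be fixed in one
  block of variables at a time.\<close>

definition mpoly_part :: "(monom \<Rightarrow> bool) \<Rightarrow> 'a::field mpoly \<Rightarrow> 'a mpoly" where
  "mpoly_part Q F =
    (\<Sum>t | t \<in> Poly_Mapping.keys F \<and> Q t. Poly_Mapping.single t (Poly_Mapping.lookup F t))"

lemma lookup_mpoly_part:
  "Poly_Mapping.lookup (mpoly_part Q F) t = (if Q t then Poly_Mapping.lookup F t else 0)"
  by (auto simp: mpoly_part_def lookup_sum lookup_single when_def in_keys_iff)

lemma keys_mpoly_part:
  "Poly_Mapping.keys (mpoly_part Q F) = {t \<in> Poly_Mapping.keys F. Q t}"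
  by (auto simp: in_keys_iff lookup_mpoly_part split: if_splits)

lemma mpoly_part_mem: "F \<in> carrier (mpoly_ring k n) \<Longrightarrow> mpoly_part Q F \<in> carrier (mpoly_ring k n)"
  by (auto simp: mem_mpoly_ring keys_mpoly_part)

lemma mpoly_part_part: "mpoly_part Q (mpoly_part Q' F) = mpoly_part (\<lambda>t. Q' t \<and> Q t) F"
  by (rule poly_mapping_eqI) (auto simp: lookup_mpoly_part)

lemma mpoly_part_diff: "mpoly_part Q (F - G) = mpoly_part Q F - mpoly_part Q G"
  by (rule poly_mapping_eqI) (auto simp: lookup_mpoly_part lookup_minus)

lemma mpoly_part_eq_self: "(\<And>t. t \<in> Poly_Mapping.keys F \<Longrightarrow> Q t) \<Longrightarrow> mpoly_part Q F = F"
  by (rule poly_mapping_eqI) (auto simp: lookup_mpoly_part in_keys_iff)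

lemma mpoly_part_eq_0: "(\<And>t. t \<in> Poly_Mapping.keys F \<Longrightarrow> \<not> Q t) \<Longrightarrow> mpoly_part Q F = 0"
  by (rule poly_mapping_eqI) (auto simp: lookup_mpoly_part in_keys_iff)

lemma eval_mpoly_part:
  "eval_mpoly a (mpoly_part Q F) = (\<Sum>t | t \<in> Poly_Mapping.keys F \<and> Q t.
    Poly_Mapping.lookup F t * (\<Prod>v\<in>Poly_Mapping.keys t. a v ^ Poly_Mapping.lookup t v))"
  unfolding mpoly_part_def eval_mpoly_sum eval_mpoly_single ..

text \<open>Only the multidegrees in \<open>{1..k}\<close> are compared, as in \<^const>\<open>forms\<close>.\<close>
definition component :: "nat \<Rightarrow> (nat \<Rightarrow> nat) \<Rightarrow> (nat \<Rightarrow> nat) \<Rightarrow> 'a::field mpoly \<Rightarrow> 'a mpoly" where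
  "component k n j = mpoly_part (\<lambda>t. \<forall>l\<in>{1..k}. multideg n t l = j l)"

lemma component_mem_forms:
  "F \<in> carrier (mpoly_ring k n) \<Longrightarrow> component k n j F \<in> forms k n j"
  by (auto simp: component_def mem_forms mpoly_part_mem keys_mpoly_part)

lemma component_form: "F \<in> forms k n j \<Longrightarrow> component k n j F = F"
  by (auto simp: component_def mem_forms intro: mpoly_part_eq_self)

text \<open>Every monomial of \<open>L\<close> shifts multidegrees by exactly \<open>i\<close>. The
  remainder \<open>G\<close> of \<open>F\<close> has no monomial of multidegree \<open>j\<close>, so
  \<open>L * G\<close> has none of multidegree \<open>i + j\<close>.\<close>

lemma component_mult_form:
  assumes L: "L \<in> forms k n i" and F: "F \<in> carrier (mpoly_ring k n)"
  shows "component k n (\<lambda>l. i l + j l) (L * F) = L * component k n j F"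
proof -
  define G where "G = F - component k n j F"
  have "Poly_Mapping.lookup G t = 0" if "\<forall>l\<in>{1..k}. multideg n t l = j l" for t
    using that by (simp add: G_def lookup_minus component_def lookup_mpoly_part)
  hence G: "\<exists>l\<in>{1..k}. multideg n t l \<noteq> j l" if "t \<in> Poly_Mapping.keys G" for t
    using that by (auto simp: in_keys_iff)
  have "component k n (\<lambda>l. i l + j l) (L * G) = 0"
    unfolding component_def
  proof (rule mpoly_part_eq_0)
    fix t assume "t \<in> Poly_Mapping.keys (L * G)"
    then obtain a b where ab: "t = a + b" "a \<in> Poly_Mapping.keys L" "b \<in> Poly_Mapping.keys G"
      using Poly_Mapping.keys_mult[of L G] by blast
    obtain l where l: "l \<in> {1..k}" "multideg n b l \<noteq> j l" using G ab(3) by blast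
    moreover have "multideg n a l = i l" using L ab l by (auto simp: mem_forms)
    ultimately show "\<not> (\<forall>l\<in>{1..k}. multideg n t l = i l + j l)"
      using ab by (auto simp: multideg_add intro!: bexI[of _ l])
  qed
  moreover have "L * G = L * F - L * component k n j F"
    by (simp add: G_def algebra_simps)
  moreover have "component k n (\<lambda>l. i l + j l) (L * component k n j F) = L * component k n j F"
    by (intro component_form forms_mult L component_mem_forms F)
  ultimately show ?thesis
    by (simp add: component_def mpoly_part_diff)
qed

text \<open>Restricting multidegrees to \<open>{1..k}\<close> gives each component a single index;
  functions differing only outside \<open>{1..k}\<close> would count one component several
  times.\<close>

lemma sum_components:
  "F = (\<Sum>j\<in>(\<lambda>t. \<lambda>l\<in>{1..k}. multideg n t l) ` Poly_Mapping.keys F. component k n j F)"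
proof (rule poly_mapping_eqI)
  fix t
  define D where "D = (\<lambda>t. \<lambda>l\<in>{1..k}. multideg n t l) ` Poly_Mapping.keys F"
  have *: "(\<forall>l\<in>{1..k}. multideg n t l = j l) \<longleftrightarrow> j = (\<lambda>l\<in>{1..k}. multideg n t l)" if "j \<in> D" for j
    using that by (auto simp: D_def restrict_def fun_eq_iff)
  have "Poly_Mapping.lookup (\<Sum>j\<in>D. component k n j F) t =
      (\<Sum>j\<in>D. if j = (\<lambda>l\<in>{1..k}. multideg n t l) then Poly_Mapping.lookup F t else 0)"
    unfolding lookup_sum component_def lookup_mpoly_part by (intro sum.cong refl) (auto simp only: *)
  also have "\<dots> = Poly_Mapping.lookup F t"
    by (auto simp: D_def in_keys_iff)
  finally show "Poly_Mapping.lookup F t =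
      Poly_Mapping.lookup (\<Sum>j\<in>(\<lambda>t. \<lambda>l\<in>{1..k}. multideg n t l) ` Poly_Mapping.keys F. component k n j F) t"
    by (simp add: D_def)
qed

lemma finite_monoms_multideg:
  "finite {t. Poly_Mapping.keys t \<subseteq> var_indices k n \<and> (\<forall>l\<in>{1..k}. multideg n t l = j l)}"
    (is "finite ?M")
proof (rule finite_imageD)
  \<comment> \<open>The exponent at \<open>(l, m)\<close> is at most \<open>j l\<close>. The union
    gives one finite codomain for all exponents.\<close>
  let ?B = "\<Union>l\<in>{1..k}. {0..j l}"
  show "inj_on Poly_Mapping.lookup ?M" by (simp add: inj_on_def Poly_Mapping.lookup_inject)
  have "finite {f. \<forall>x. (x \<in> var_indices k n \<longrightarrow> f x \<in> ?B) \<and> (x \<notin> var_indices k n \<longrightarrow> f x = 0)}"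
    by (rule finite_set_of_finite_funs) auto
  moreover have "Poly_Mapping.lookup ` ?M \<subseteq>
      {f. \<forall>x. (x \<in> var_indices k n \<longrightarrow> f x \<in> ?B) \<and> (x \<notin> var_indices k n \<longrightarrow> f x = 0)}"
  proof (intro image_subsetI CollectI allI conjI impI)
    fix t v assume t: "t \<in> ?M" and v: "v \<in> var_indices k n"
    obtain l m where lm: "v = (l, m)" "l \<in> {1..k}" "m \<le> n l"
      using v by (auto simp: var_indices_def)
    have "Poly_Mapping.lookup t (l, m) \<le> multideg n t l"
      unfolding multideg_def using lm by (intro member_le_sum) auto
    thus "Poly_Mapping.lookup t v \<in> ?B" using t lm by auto
  next
    fix t v assume "t \<in> ?M" "v \<notin> var_indices k n"
    thus "Poly_Mapping.lookup t v = 0" by (auto simp: in_keys_iff)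
  qed
  ultimately show "finite (Poly_Mapping.lookup ` ?M)" by (rule rev_finite_subset)
qed

section \<open>Depth one\<close>

text \<open>Makes the first condition in \<open>regular_sequence\<close> the usual one: the first
  element is a nonzerodivisor on the ring itself.\<close>

lemma (in ring) genideal_empty: "Idl {} = {\<zero>}"
  using genideal_minimal[OF zeroideal, of "{}"] ideal.axioms(1)[OF genideal_ideal[of "{}"]]
    additive_subgroup.zero_closed by fastforce

lemma (in cring) mem_genideal_singleton:
  assumes "a \<in> carrier R"
  shows "x \<in> Idl {a} \<longleftrightarrow> (\<exists>b\<in>carrier R. x = a \<otimes> b)"
  using cgenideal_eq_genideal[OF assms] assms by (auto simp: cgenideal_def m_comm)

lemma (in cring) nonzerodivisor_cancel:
  assumes "f \<otimes> a = f \<otimes> b" "\<And>a. a \<in> carrier R \<Longrightarrow> f \<otimes> a = \<zero> \<Longrightarrow> a = \<zero>"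
    "a \<in> carrier R" "b \<in> carrier R" "f \<in> carrier R"
  shows "a = b"
proof -
  have "f \<otimes> (a \<ominus> b) = f \<otimes> a \<ominus> f \<otimes> b" using assms(3-5) by algebra
  hence "a \<ominus> b = \<zero>" using assms by (simp add: r_right_minus_eq)
  thus ?thesis using assms by (simp add: r_right_minus_eq)
qed

text \<open>Suppose that a regular sequence in \<open>J\<close> starts with \<open>p\<close>,
  \<open>q\<close>, and write \<open>p g = L a\<close>, \<open>q g = L b\<close>. Cancelling
  \<open>L\<close> from \<open>L (q a) = L (p b)\<close> gives \<open>q a = p b\<close>. As
  \<open>q\<close> is regular modulo \<open>p\<close>, this yields \<open>a = p c\<close>, and
  cancelling \<open>p\<close> from \<open>p g = p L c\<close> gives \<open>g = L c\<close>, a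
  contradiction.\<close>

lemma (in cring) depth_eq_one:
  assumes J: "ideal J R" and L: "L \<in> J"
    and nzd: "\<And>a. a \<in> carrier R \<Longrightarrow> L \<otimes> a = \<zero> \<Longrightarrow> a = \<zero>"
    and g: "g \<in> carrier R" "\<And>a. a \<in> carrier R \<Longrightarrow> g \<noteq> L \<otimes> a"
    and socle: "\<And>x. x \<in> J \<Longrightarrow> \<exists>a\<in>carrier R. x \<otimes> g = L \<otimes> a"
  shows "depth R J = 1"
proof -
  let ?S = "{enat (length fs) | fs. set fs \<subseteq> J \<and> regular_sequence R fs}"
  have Jc: "J \<subseteq> carrier R" using J by (simp add: ideal.Icarr subsetI)
  have Lc: "L \<in> carrier R" using L Jc by blast
  have "length fs \<le> 1" if fs: "set fs \<subseteq> J" "regular_sequence R fs" for fs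
  proof (rule ccontr)
    assume "\<not> length fs \<le> 1"
    \<comment> \<open>The case rule separates lists with no, one, and at least two elements.\<close>
    then obtain p q gs where fs_eq: "fs = p # q # gs"
      by (cases fs rule: remdups_adj.cases) auto
    have pq: "p \<in> J" "q \<in> J" "p \<in> carrier R" "q \<in> carrier R" using fs fs_eq Jc by auto
    have p: "a = \<zero>" if "a \<in> carrier R" "p \<otimes> a = \<zero>" for a
    proof -
      have "\<forall>a\<in>carrier R. fs ! 0 \<otimes> a \<in> Idl (set (take 0 fs)) \<longrightarrow> a \<in> Idl (set (take 0 fs))"
        using fs(2) fs_eq unfolding regular_sequence_def by blast
      thus ?thesis using that by (simp add: fs_eq genideal_empty)
    qed
    have q: "a \<in> Idl {p}" if "a \<in> carrier R" "q \<otimes> a \<in> Idl {p}" for a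
    proof -
      have "1 < length fs" by (simp add: fs_eq)
      hence "\<forall>a\<in>carrier R. fs ! 1 \<otimes> a \<in> Idl (set (take 1 fs)) \<longrightarrow> a \<in> Idl (set (take 1 fs))"
        using fs(2) unfolding regular_sequence_def by blast
      thus ?thesis using that by (simp add: fs_eq)
    qed
    obtain a b where ab: "a \<in> carrier R" "b \<in> carrier R" "p \<otimes> g = L \<otimes> a" "q \<otimes> g = L \<otimes> b"
      using socle pq(1,2) by meson
    have "L \<otimes> (q \<otimes> a) = q \<otimes> (p \<otimes> g)" unfolding ab(3) using ab(1,2) pq Lc by algebra
    also have "\<dots> = p \<otimes> (q \<otimes> g)" using pq g by algebra
    also have "\<dots> = L \<otimes> (p \<otimes> b)" unfolding ab(4) using ab(1,2) pq Lc by algebra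
    finally have "q \<otimes> a = p \<otimes> b" by (rule nonzerodivisor_cancel) (use nzd ab pq Lc in auto)
    hence "a \<in> Idl {p}" using q ab pq by (auto simp: mem_genideal_singleton)
    then obtain c where c: "c \<in> carrier R" "a = p \<otimes> c" using pq by (auto simp: mem_genideal_singleton)
    have "p \<otimes> g = p \<otimes> (L \<otimes> c)" unfolding ab(3) c(2) using c(1) pq Lc by algebra
    hence "g = L \<otimes> c" by (rule nonzerodivisor_cancel) (use p pq g c Lc in auto)
    thus False using g c by blast
  qed
  hence le: "Sup ?S \<le> 1" by (auto intro!: Sup_least simp: one_enat_def)
  have "regular_sequence R [L]"
  proof -
    \<comment> \<open>\<open>g\<close> witnesses that \<open>L\<close> generates a proper
      ideal.\<close>
    have "g \<notin> Idl {L}" using g Lc by (auto simp: mem_genideal_singleton)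
    thus ?thesis using Lc nzd g(1) by (auto simp: regular_sequence_def genideal_empty)
  qed
  hence "enat (length [L]) \<in> ?S" using L by (auto intro!: exI[of _ "[L]"])
  hence "enat (length [L]) \<le> Sup ?S" by (rule Sup_upper)
  hence "1 \<le> Sup ?S" by (simp add: one_enat_def)
  with le show ?thesis unfolding depth_def by simp
qed

section \<open>Dimensions over a subfield\<close>

text \<open>Multiplication by a nonzerodivisor is an injective linear map. It carries line
  extensions to line extensions, and cancellation keeps each new vector outside the image of the
  space built so far.\<close>

lemma (in cring) dimension_mult_image:
  assumes K: "subfield K R" and "dimension d K E" and L: "L \<in> carrier R"
    and nzd: "\<And>a. a \<in> carrier R \<Longrightarrow> L \<otimes> a = \<zero> \<Longrightarrow> a = \<zero>"
  shows "dimension d K ((\<otimes>) L ` E)"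
  using assms(2,1)
proof (induction rule: dimension.induct)
  case (zero_dim K)
  thus ?case using L by simp
next
  case (Suc_dim v E d K)
  have E: "E \<subseteq> carrier R" using space_subgroup_props(1)[OF Suc_dim.prems Suc_dim.hyps(3)] .
  have Kc: "K \<subseteq> carrier R" using subfieldE(3)[OF Suc_dim.prems] .
  have "L \<otimes> v \<notin> (\<otimes>) L ` E"
  proof
    assume "L \<otimes> v \<in> (\<otimes>) L ` E"
    then obtain w where w: "w \<in> E" "L \<otimes> v = L \<otimes> w" by blast
    have "v = w"
      by (rule nonzerodivisor_cancel[OF w(2)]) (use nzd w(1) E Suc_dim.hyps(1) L in auto)
    thus False using w Suc_dim.hyps by blast
  qed
  moreover have "line_extension K (L \<otimes> v) ((\<otimes>) L ` E) = (\<otimes>) L ` line_extension K v E"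
  proof -
    have *: "c \<otimes> (L \<otimes> v) \<oplus> L \<otimes> w = L \<otimes> (c \<otimes> v \<oplus> w)" if "c \<in> K" "w \<in> E" for c w
    proof -
      have "c \<in> carrier R" "w \<in> carrier R" using that Kc E by auto
      thus ?thesis using L Suc_dim.hyps(1) by algebra
    qed
    show ?thesis
    proof (intro equalityI subsetI)
      fix x assume "x \<in> line_extension K (L \<otimes> v) ((\<otimes>) L ` E)"
      then obtain c w where cw: "c \<in> K" "w \<in> E" "x = c \<otimes> (L \<otimes> v) \<oplus> L \<otimes> w"
        unfolding line_extension_mem_iff by blast
      hence "c \<otimes> v \<oplus> w \<in> line_extension K v E" unfolding line_extension_mem_iff by blast
      thus "x \<in> (\<otimes>) L ` line_extension K v E" using cw * by blast
    next
      fix x assume "x \<in> (\<otimes>) L ` line_extension K v E"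
      then obtain y where "y \<in> line_extension K v E" "x = L \<otimes> y" by blast
      then obtain c w where cw: "c \<in> K" "w \<in> E" "x = L \<otimes> (c \<otimes> v \<oplus> w)"
        unfolding line_extension_mem_iff by blast
      thus "x \<in> line_extension K (L \<otimes> v) ((\<otimes>) L ` E)"
        unfolding line_extension_mem_iff using *[OF cw(1,2)] by force
    qed
  qed
  ultimately show ?case
    using dimension.Suc_dim[of "L \<otimes> v" "(\<otimes>) L ` E" d K] Suc_dim L by auto
qed

text \<open>A basis of \<open>E\<close> is an independent family in \<open>F\<close> whose length is
  the dimension of \<open>F\<close>, so it spans \<open>F\<close>.\<close>

lemma (in ring) dimension_subset_eq:
  assumes "subfield K R" "dimension d K E" "dimension d K F" "E \<subseteq> F"
  shows "E = F"
proof -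
  obtain Us where Us: "independent K Us" "length Us = d" "Span K Us = E" "set Us \<subseteq> carrier R"
    using exists_base[OF assms(1,2)] by blast
  have "set Us \<subseteq> F" using Span_base_incl[OF assms(1) Us(4)] Us assms(4) by blast
  thus ?thesis using independent_length_eq_dimension[OF assms(1,3) Us(1)] Us by blast
qed

lemma (in ring) dimension_dim:
  assumes "subfield K R" "finite_dimension K E"
  shows "dimension (dim K E) K E"
  using finite_dimensionE[OF assms] by (simp add: over_def)

section \<open>The cone over a point\<close>

definition represents ::
    "nat \<Rightarrow> (nat \<Rightarrow> nat) \<Rightarrow> (nat \<Rightarrow> nat \<Rightarrow> 'a::field) \<Rightarrow> (nat \<Rightarrow> (nat \<Rightarrow> 'a) set) \<Rightarrow> bool" where
  "represents k n u P \<longleftrightarrow>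
     (\<forall>l\<in>{1..k}. u l \<in> nonzero_vecs (n l) \<and> P l = {\<lambda>m. c * u l m | c. c \<noteq> 0})"

lemma ex_represents:
  assumes "P \<in> multiproj_space k n"
  shows "\<exists>u. represents k n u P"
proof -
  have "\<exists>v. v \<in> nonzero_vecs (n l) \<and> P l = {\<lambda>m. c * v m | c. c \<noteq> 0}" if "l \<in> {1..k}" for l
  proof -
    have "P l \<in> nonzero_vecs (n l) // proportional (n l)"
      using assms that by (auto simp: multiproj_space_def proj_space_def)
    then obtain v where v: "v \<in> nonzero_vecs (n l)" "P l = proportional (n l) `` {v}"
      by (auto elim: quotientE)
    have "(\<lambda>m. c * v m) \<in> nonzero_vecs (n l)" if "c \<noteq> 0" for c
      using v that by (auto simp: nonzero_vecs_def)
    thus ?thesis using v by (intro exI[of _ v]) (auto simp: proportional_def)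
  qed
  thus ?thesis unfolding represents_def by (intro bchoice) blast
qed

text \<open>The cone over a point of the multiprojective space consists of all \<open>cone_point u c\<close>, where
  \<open>u\<close> represents the point and the coefficients \<open>c\<close> may vanish.\<close>
definition cone_point :: "(nat \<Rightarrow> nat \<Rightarrow> 'a::field) \<Rightarrow> (nat \<Rightarrow> 'a) \<Rightarrow> nat \<times> nat \<Rightarrow> 'a" where
  "cone_point u c = (\<lambda>(l, m). c l * u l m)"

text \<open>The parametrisation of the cone is linear in the coefficients, so lines of coefficients
  become lines of points.\<close>

lemma cone_point_line:
  "cone_point u (\<lambda>l. c l + x * (d l - c l)) =
    (\<lambda>v. cone_point u c v + x * (cone_point u d v - cone_point u c v))"
  by (auto simp: cone_point_def algebra_simps fun_eq_iff)

lemma eval_cone_line: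
  fixes u :: "nat \<Rightarrow> nat \<Rightarrow> 'a::field"
  shows "\<exists>p. \<forall>x. poly p x = eval_mpoly (cone_point u (\<lambda>l. c l + x * (d l - c l))) F"
  unfolding cone_point_line by (rule eval_mpoly_line)

section \<open>Density and homogeneity arguments on the cone\<close>

lemma poly_eq_0_cofinite:
  fixes p :: "'a::field_char_0 poly"
  assumes "finite S" "\<And>x. x \<notin> S \<Longrightarrow> poly p x = 0"
  shows "p = 0"
proof (rule ccontr)
  assume "p \<noteq> 0"
  hence "finite {x. poly p x = 0}" by (rule poly_roots_finite)
  moreover have "UNIV \<subseteq> S \<union> {x. poly p x = 0}" using assms by blast
  ultimately show False
    using assms(1) infinite_UNIV_char_0[where ?'a = 'a] by (meson finite_UnI finite_subset)
qed

text \<open>Join \<open>c\<close> to the all-ones vector. Each coefficient is 1 at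
  \<open>x = 1\<close>, so it is a nonzero polynomial in \<open>x\<close> and vanishes for finitely
  many \<open>x\<close> only. Hence the restriction of \<open>F\<close> to the line has cofinitely
  many zeros and is 0, in particular at \<open>x = 0\<close>.\<close>

lemma cone_vanishing_dense:
  fixes u :: "nat \<Rightarrow> nat \<Rightarrow> 'a::field_char_0"
  assumes nz: "\<And>c. \<forall>l\<in>{1..k}. c l \<noteq> 0 \<Longrightarrow> eval_mpoly (cone_point u c) F = 0"
  shows "eval_mpoly (cone_point u c) F = 0"
proof -
  obtain p where p: "\<And>x. poly p x = eval_mpoly (cone_point u (\<lambda>l. c l + x * (1 - c l))) F"
    using eval_cone_line[of u c "\<lambda>_. 1" F] by auto
  have "p = 0"
  proof (rule poly_eq_0_cofinite)
    show "finite (\<Union>l\<in>{1..k}. {x. poly [:c l, 1 - c l:] x = 0})"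
      by (intro finite_UN_I poly_roots_finite) auto
    show "poly p x = 0" if "x \<notin> (\<Union>l\<in>{1..k}. {x. poly [:c l, 1 - c l:] x = 0})" for x
      unfolding p using that by (intro nz) auto
  qed
  thus "eval_mpoly (cone_point u c) F = 0" using p[of 0] by simp
qed

text \<open>The representatives in \<open>vanishes_at\<close> are the cone points with all
  coefficients nonzero; density adds those with zero coefficients. Homogeneity of \<open>F\<close>
  is not assumed.\<close>

lemma vanishes_at_iff:
  fixes u :: "nat \<Rightarrow> nat \<Rightarrow> 'a::field_char_0"
  assumes u: "represents k n u P" and F: "F \<in> carrier (mpoly_ring k n)"
  shows "vanishes_at k F P \<longleftrightarrow> (\<forall>c. eval_mpoly (cone_point u c) F = 0)"
proof
  assume *: "\<forall>c. eval_mpoly (cone_point u c) F = 0"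
  show "vanishes_at k F P"
    unfolding vanishes_at_def
  proof (intro allI impI)
    fix v assume "\<forall>l\<in>{1..k}. v l \<in> P l"
    hence "\<forall>l\<in>{1..k}. \<exists>c. v l = (\<lambda>m. c * u l m)" using u by (force simp: represents_def)
    then obtain c where c: "\<forall>l\<in>{1..k}. v l = (\<lambda>m. c l * u l m)" using bchoice by metis
    have "eval_mpoly (\<lambda>(l, m). v l m) F = eval_mpoly (cone_point u c) F"
      by (rule eval_mpoly_cong[OF F]) (use c in \<open>auto simp: var_indices_def cone_point_def\<close>)
    thus "eval_mpoly (\<lambda>(l, m). v l m) F = 0" using * by simp
  qed
next
  assume v: "vanishes_at k F P"
  have nz: "eval_mpoly (cone_point u c) F = 0" if "\<forall>l\<in>{1..k}. c l \<noteq> 0" for c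
  proof -
    have "\<forall>l\<in>{1..k}. (\<lambda>m. c l * u l m) \<in> P l" using u that by (auto simp: represents_def)
    hence "eval_mpoly (\<lambda>(l, m). (\<lambda>m. c l * u l m) m) F = 0"
      using v unfolding vanishes_at_def by (elim allE[of _ "\<lambda>l m. c l * u l m"]) simp
    thus ?thesis by (simp add: cone_point_def)
  qed
  show "\<forall>c. eval_mpoly (cone_point u c) F = 0"
    by (rule allI, rule cone_vanishing_dense, rule nz)
qed

text \<open>Only the variables of block \<open>l\<close> are rescaled, and their exponents add up to
  \<open>multideg n t l\<close>.\<close>

lemma eval_monom_cone_scale:
  fixes u :: "nat \<Rightarrow> nat \<Rightarrow> 'a::field"
  assumes "Poly_Mapping.keys t \<subseteq> var_indices k n" "l \<in> {1..k}"
  shows "(\<Prod>v\<in>Poly_Mapping.keys t. cone_point u (c(l := x * c l)) v ^ Poly_Mapping.lookup t v) =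
    x ^ multideg n t l * (\<Prod>v\<in>Poly_Mapping.keys t. cone_point u c v ^ Poly_Mapping.lookup t v)"
proof -
  have "(\<Prod>v\<in>var_indices k n. cone_point u (c(l := x * c l)) v ^ Poly_Mapping.lookup t v) =
    (\<Prod>v\<in>var_indices k n. (if fst v = l then x ^ Poly_Mapping.lookup t v else 1) *
      cone_point u c v ^ Poly_Mapping.lookup t v)"
    by (intro prod.cong) (auto simp: cone_point_def power_mult_distrib)
  also have "\<dots> = (\<Prod>v\<in>var_indices k n. if fst v = l then x ^ Poly_Mapping.lookup t v else 1) *
      (\<Prod>v\<in>var_indices k n. cone_point u c v ^ Poly_Mapping.lookup t v)"
    by (rule prod.distrib)
  also have "(\<Prod>v\<in>var_indices k n. if fst v = l then x ^ Poly_Mapping.lookup t v else 1) =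
      (\<Prod>v\<in>Pair l ` {0..n l}. x ^ Poly_Mapping.lookup t v)"
    using assms(2) by (intro prod.mono_neutral_cong_right) (auto simp: var_indices_def)
  also have "\<dots> = x ^ multideg n t l"
    by (subst prod.reindex) (auto simp: inj_on_def multideg_def power_sum)
  finally show ?thesis
    unfolding eval_monom_superset[OF finite_var_indices assms(1)] .
qed

text \<open>Scaling the \<open>l\<close>-th block of coordinates by \<open>x\<close> turns the value of a polynomial into a
  polynomial in \<open>x\<close>, whose coefficients are the values of the homogeneous parts.\<close>
lemma cone_vanishing_part:
  fixes u :: "nat \<Rightarrow> nat \<Rightarrow> 'a::field_char_0"
  assumes F: "F \<in> carrier (mpoly_ring k n)" and l: "l \<in> {1..k}"
    and "\<And>c. eval_mpoly (cone_point u c) F = 0"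
  shows "eval_mpoly (cone_point u c) (mpoly_part (\<lambda>t. multideg n t l = d) F) = 0"
proof -
  define w where "w = (\<lambda>t. Poly_Mapping.lookup F t *
    (\<Prod>v\<in>Poly_Mapping.keys t. cone_point u c v ^ Poly_Mapping.lookup t v))"
  define p where "p = (\<Sum>t\<in>Poly_Mapping.keys F. Polynomial.monom (w t) (multideg n t l))"
  have "poly p x = eval_mpoly (cone_point u (c(l := x * c l))) F" for x
    unfolding eval_mpoly_def p_def poly_sum poly_monom w_def
  proof (intro sum.cong refl)
    fix t assume "t \<in> Poly_Mapping.keys F"
    hence "Poly_Mapping.keys t \<subseteq> var_indices k n" using F by (auto simp: mem_mpoly_ring)
    thus "Poly_Mapping.lookup F t *
        (\<Prod>v\<in>Poly_Mapping.keys t. cone_point u c v ^ Poly_Mapping.lookup t v) * x ^ multideg n t l =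
      Poly_Mapping.lookup F t * (\<Prod>v\<in>Poly_Mapping.keys t.
        cone_point u (c(l := x * c l)) v ^ Poly_Mapping.lookup t v)"
      using l by (simp add: eval_monom_cone_scale)
  qed
  hence "p = 0" using assms(3) by (intro poly_eq_0_cofinite[of "{}"]) auto
  hence "Polynomial.coeff p d = 0" by simp
  hence "(\<Sum>t\<in>Poly_Mapping.keys F. if multideg n t l = d then w t else 0) = 0"
    by (simp add: p_def Polynomial.coeff_sum)
  thus ?thesis
    by (simp add: eval_mpoly_part w_def sum.If_cases Collect_conj_eq)
qed

text \<open>Induction on the set of blocks in which the degree has been fixed; each block is split
  off by \<open>cone_vanishing_part\<close>.\<close>

lemma cone_vanishing_component:
  fixes u :: "nat \<Rightarrow> nat \<Rightarrow> 'a::field_char_0"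
  assumes F: "F \<in> carrier (mpoly_ring k n)" and v: "\<And>c. eval_mpoly (cone_point u c) F = 0"
  shows "eval_mpoly (cone_point u c) (component k n j F) = 0"
proof -
  have "\<forall>c. eval_mpoly (cone_point u c) (mpoly_part (\<lambda>t. \<forall>l\<in>S. multideg n t l = j l) F) = 0"
    if "finite S" "S \<subseteq> {1..k}" for S
    using that
  proof (induction S rule: finite_induct)
    case empty
    thus ?case using v by (simp add: mpoly_part_eq_self)
  next
    case (insert l S)
    have "mpoly_part (\<lambda>t. \<forall>l\<in>insert l S. multideg n t l = j l) F =
      mpoly_part (\<lambda>t. multideg n t l = j l) (mpoly_part (\<lambda>t. \<forall>l\<in>S. multideg n t l = j l) F)"
      unfolding mpoly_part_part by (rule arg_cong[of _ _ "\<lambda>Q. mpoly_part Q F"]) auto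
    thus ?case using insert
      by (auto intro!: cone_vanishing_part[where k = k] mpoly_part_mem F)
  qed
  thus ?thesis by (simp add: component_def)
qed

section \<open>The ideal of a set of points\<close>

locale point_set =
  fixes k :: nat and n :: "nat \<Rightarrow> nat"
    and \<XX> :: "(nat \<Rightarrow> (nat \<Rightarrow> 'a::{alg_closed_field, field_char_0}) set) set"
  assumes points: "\<XX> \<subseteq> multiproj_space k n" and finite_points: "finite \<XX>" and nonempty: "\<XX> \<noteq> {}"
begin

abbreviation R :: "'a mpoly ring" where "R \<equiv> mpoly_ring k n"
abbreviation A :: "'a mpoly set ring" where "A \<equiv> coord_ring k n \<XX>"
abbreviation rc :: "'a mpoly \<Rightarrow> 'a mpoly set" where "rc \<equiv> residue_class k n \<XX>"

definition rep :: "(nat \<Rightarrow> (nat \<Rightarrow> 'a) set) \<Rightarrow> nat \<Rightarrow> nat \<Rightarrow> 'a" where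
  "rep P = (SOME u. represents k n u P)"

lemma represents_rep:
  assumes "P \<in> \<XX>"
  shows "represents k n (rep P) P"
proof -
  have "\<exists>u. represents k n u P" using assms points by (intro ex_represents) blast
  thus ?thesis unfolding rep_def by (rule someI_ex)
qed

lemma vanishes_at_rep:
  "P \<in> \<XX> \<Longrightarrow> F \<in> carrier R \<Longrightarrow>
    vanishes_at k F P \<longleftrightarrow> (\<forall>c. eval_mpoly (cone_point (rep P) c) F = 0)"
  using vanishes_at_iff[OF represents_rep] by blast

sublocale R: cring "mpoly_ring k n :: 'a mpoly ring" by (rule cring_mpoly_ring)

lemma ideal_evalI:
  assumes "\<And>F. F \<in> I \<longleftrightarrow> F \<in> carrier R \<and> (\<forall>a\<in>D. eval_mpoly a F = 0)"
  shows "ideal I R"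
proof (rule idealI)
  show "subgroup I (add_monoid R)"
  proof (rule R.add.subgroupI)
    show "\<ominus>\<^bsub>R\<^esub> F \<in> I" if "F \<in> I" for F
    proof -
      have "\<ominus>\<^bsub>R\<^esub> F = - F"
        using that assms by (intro R.minus_equality) (auto simp: mpoly_ring_closed)
      thus ?thesis using that by (simp add: assms mpoly_ring_closed eval_mpoly_uminus)
    qed
    have "0 \<in> I" by (simp add: assms mpoly_ring_closed)
    thus "I \<noteq> {}" by blast
  qed (auto simp: assms mpoly_ring_closed eval_mpoly_add)
qed (auto simp: assms mpoly_ring_closed eval_mpoly_mult R.ring_axioms)

lemma points_ideal_iff:
  "F \<in> points_ideal k n \<XX> \<longleftrightarrow>
    F \<in> carrier R \<and> (\<forall>P\<in>\<XX>. \<forall>c. eval_mpoly (cone_point (rep P) c) F = 0)"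
proof -
  define V where "V = {F \<in> carrier R. \<forall>P\<in>\<XX>. \<forall>c. eval_mpoly (cone_point (rep P) c) F = 0}"
  let ?G = "{F. \<exists>j. F \<in> forms k n j \<and> (\<forall>P\<in>\<XX>. vanishes_at k F P)}"
  have GV: "?G \<subseteq> V" by (auto simp: V_def mem_forms vanishes_at_rep)
  have "ideal V R"
    by (rule ideal_evalI[of _ "{cone_point (rep P) c | P c. P \<in> \<XX>}"]) (auto simp: V_def)
  hence "points_ideal k n \<XX> \<subseteq> V"
    unfolding points_ideal_def using GV by (rule R.genideal_minimal)
  moreover have "F \<in> points_ideal k n \<XX>" if F: "F \<in> V" for F
  proof -
    have G: "?G \<subseteq> carrier R" by (auto simp: mem_forms)
    interpret I: ideal "points_ideal k n \<XX>" R
      unfolding points_ideal_def using G by (rule R.genideal_ideal)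
    have sums: "(\<Sum>i\<in>S. f i) \<in> points_ideal k n \<XX>"
      if "\<And>i. i \<in> S \<Longrightarrow> f i \<in> points_ideal k n \<XX>" for S :: "(nat \<Rightarrow> nat) set" and f
      using that
    proof (induction S rule: infinite_finite_induct)
      case (insert x S)
      thus ?case using I.a_closed[of "f x" "\<Sum>i\<in>S. f i"] by simp
    qed (use I.zero_closed in auto)
    \<comment> \<open>Every component of \<open>F\<close> is a form vanishing on all the cones,
      hence one of the generators, and \<open>F\<close> is the sum of its components.\<close>
    have "component k n j F \<in> ?G" for j
    proof -
      have form: "component k n j F \<in> forms k n j"
        using F by (intro component_mem_forms) (simp add: V_def)
      hence "component k n j F \<in> carrier R" by (simp add: mem_forms)
      moreover have "eval_mpoly (cone_point (rep P) c) (component k n j F) = 0" if "P \<in> \<XX>" for P c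
        by (rule cone_vanishing_component) (use F that in \<open>auto simp: V_def\<close>)
      ultimately show ?thesis using form by (auto simp: vanishes_at_rep)
    qed
    hence "component k n j F \<in> points_ideal k n \<XX>" for j
      unfolding points_ideal_def using R.genideal_self[OF G] by blast
    thus ?thesis
      by (subst sum_components[of F k n]) (rule sums)
  qed
  ultimately show ?thesis by (auto simp: V_def)
qed

lemma ideal_points_ideal: "ideal (points_ideal k n \<XX>) R"
  by (rule ideal_evalI[of _ "{cone_point (rep P) c | P c. P \<in> \<XX>}"]) (auto simp: points_ideal_iff)

sublocale A: cring "coord_ring k n \<XX>"
  unfolding coord_ring_def
  by (rule ideal.quotient_is_cring[OF ideal_points_ideal cring_mpoly_ring])

sublocale rc: ring_hom_ring "mpoly_ring k n :: 'a mpoly ring" "coord_ring k n \<XX>" "residue_class k n \<XX>"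
  unfolding coord_ring_def residue_class_def[abs_def]
  by (rule ideal.rcos_ring_hom_ring[OF ideal_points_ideal])

lemma carrier_A: "carrier A = rc ` carrier R"
  by (auto simp: coord_ring_def FactRing_def A_RCOSETS_def' residue_class_def)

text \<open>Identifies \<open>A\<close> with a ring of functions on the union of the cones, so that
  identities in \<open>A\<close> can be checked by evaluation.\<close>

lemma rc_eq_iff:
  assumes "F \<in> carrier R" "G \<in> carrier R"
  shows "rc F = rc G \<longleftrightarrow>
    (\<forall>P\<in>\<XX>. \<forall>c. eval_mpoly (cone_point (rep P) c) F = eval_mpoly (cone_point (rep P) c) G)"
  using R.quotient_eq_iff_same_a_r_cos[OF ideal_points_ideal assms] assms
  by (simp add: residue_class_def minus_mpoly_ring points_ideal_iff mpoly_ring_closed eval_mpoly_diff)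

lemma rc_mult: "F \<in> carrier R \<Longrightarrow> G \<in> carrier R \<Longrightarrow> rc F \<otimes>\<^bsub>A\<^esub> rc G = rc (F * G)"
  using rc.hom_mult[of F G] by simp

lemma rc_add: "F \<in> carrier R \<Longrightarrow> G \<in> carrier R \<Longrightarrow> rc F \<oplus>\<^bsub>A\<^esub> rc G = rc (F + G)"
  using rc.hom_add[of F G] by simp

lemma rc_zero: "rc 0 = \<zero>\<^bsub>A\<^esub>"
  using rc.hom_zero by simp

lemma rc_uminus: "F \<in> carrier R \<Longrightarrow> \<ominus>\<^bsub>A\<^esub> rc F = rc (- F)"
  by (intro A.minus_equality) (auto simp: rc_add mpoly_ring_closed rc_zero carrier_A)

lemma rc_one: "rc 1 = \<one>\<^bsub>A\<^esub>"
  using rc.hom_one by simp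

end

section \<open>Hilbert functions and depth\<close>

lemma num_monoms_less:
  assumes "l \<in> {1..k}" "n l \<ge> 1"
  shows "num_monoms k n j < num_monoms k n (\<lambda>l'. of_bool (l' = l) + j l')"
proof -
  have "num_monoms k n j' = ((n l + j' l) choose j' l) * (\<Prod>l'\<in>{1..k} - {l}. (n l' + j' l') choose j' l')"
    for j'
    unfolding num_monoms_def using assms(1) by (subst prod.remove[of _ l]) auto
  moreover have "(\<Prod>l'\<in>{1..k} - {l}. (n l' + (of_bool (l' = l) + j l')) choose (of_bool (l' = l) + j l')) =
      (\<Prod>l'\<in>{1..k} - {l}. (n l' + j l') choose j l')"
    by (intro prod.cong) auto
  moreover have "0 < (\<Prod>l'\<in>{1..k} - {l}. (n l' + j l') choose j l')"
    by (intro prod_pos) auto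
  \<comment> \<open>By Pascal's rule the difference is \<open>(n l + j l) choose Suc (j l)\<close>,
    which is positive since \<open>n l \<ge> 1\<close>.\<close>
  moreover have "((n l + j l) choose j l) < ((n l + Suc (j l)) choose Suc (j l))"
    using assms(2) by simp
  ultimately show ?thesis by simp
qed

text \<open>Take \<open>i\<close> with the largest value of \<open>num_monoms\<close> below
  \<open>s\<close>; the zero multidegree has value 1 and so is a candidate. Raising one coordinate
  increases the value strictly, so by maximality it reaches \<open>s\<close>.\<close>

lemma ex_maximal_multidegree:
  assumes "1 < s"
  shows "\<exists>i. num_monoms k n i < s \<and>
    (\<forall>l\<in>{1..k}. n l \<ge> 1 \<longrightarrow> s \<le> num_monoms k n (\<lambda>l'. of_bool (l' = l) + i l'))"
proof -
  have "num_monoms k n (\<lambda>_. 0) < s" using assms by (simp add: num_monoms_def)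
  then obtain i where i: "num_monoms k n i < s"
    "\<And>j. num_monoms k n j < s \<Longrightarrow> num_monoms k n j \<le> num_monoms k n i"
    using ex_has_greatest_nat[of "\<lambda>j. num_monoms k n j < s" _ "num_monoms k n" s] by (metis less_imp_le)
  have "s \<le> num_monoms k n (\<lambda>l'. of_bool (l' = l) + i l')" if "l \<in> {1..k}" "n l \<ge> 1" for l
    using i(2)[of "\<lambda>l'. of_bool (l' = l) + i l'"] num_monoms_less[of l k n i] that by fastforce
  thus ?thesis using i(1) by blast
qed

context point_set
begin

section \<open>The graded pieces as finite-dimensional vector spaces\<close>

lemma A_one_not_zero: "\<one>\<^bsub>A\<^esub> \<noteq> \<zero>\<^bsub>A\<^esub>"
proof
  assume "\<one>\<^bsub>A\<^esub> = \<zero>\<^bsub>A\<^esub>"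
  hence "rc 1 = rc 0" by (simp add: rc_one rc_zero)
  thus False using nonempty by (auto simp: rc_eq_iff mpoly_ring_closed)
qed

text \<open>The image of a subfield under a ring homomorphism into a nonzero ring is a subfield.
  This makes \<open>A\<close> a vector space over the scalars used in
  \<open>hilbert_function\<close>.\<close>

lemma subfield_constants: "subfield (rc ` range Const) A"
proof (rule rc.img_is_subfield(2)[OF _ A_one_not_zero])
  have C: "Const a + Const b = Const (a + b)" "Const a * Const b = Const (a * b)"
    "Const 1 = 1" "Const 0 = 0" "- Const a = Const (- a)" for a b :: 'a
    by (simp_all add: Const_def single_add mult_single single_uminus)
  have minus: "\<ominus>\<^bsub>R\<^esub> Const a = Const (- a)" for a
    by (intro R.minus_equality) (auto simp: mpoly_ring_closed C)
  show "subfield (range Const) R"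
  proof (rule R.subfieldI)
    have "subring (range Const) R"
      by (rule R.subringI) (auto simp: mpoly_ring_closed C minus C(3)[symmetric] simp del: C(3))
    thus "subcring (range Const) R"
      by (rule R.subcringI) (auto simp: mult.commute)
    show "Units (R\<lparr>carrier := range Const\<rparr>) = range Const - {\<zero>\<^bsub>R\<^esub>}"
    proof (intro equalityI subsetI)
      fix x assume "x \<in> Units (R\<lparr>carrier := range Const\<rparr>)"
      thus "x \<in> range Const - {\<zero>\<^bsub>R\<^esub>}" by (auto simp: Units_def)
    next
      fix x assume "x \<in> range Const - {\<zero>\<^bsub>R\<^esub>}"
      then obtain a where "x = Const a" "a \<noteq> 0" by (auto simp: C(4)[symmetric] simp del: C(4))
      thus "x \<in> Units (R\<lparr>carrier := range Const\<rparr>)"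
        unfolding Units_def by (auto simp: C intro!: exI[of _ "inverse a"])
    qed
  qed
qed

lemma rc_forms_subset: "rc ` forms k n j \<subseteq> carrier A"
  by (auto simp: carrier_A mem_forms)

text \<open>The piece is a subspace of the span of the classes of the finitely many monomials of
  multidegree \<open>j\<close>. Finiteness ensures that \<open>hilbert_function\<close> is an actual
  dimension.\<close>

lemma finite_dimension_forms: "A.finite_dimension (rc ` range Const) (rc ` forms k n j)"
proof -
  obtain ts where ts: "set ts = {t. Poly_Mapping.keys t \<subseteq> var_indices k n \<and> (\<forall>l\<in>{1..k}. multideg n t l = j l)}"
    using finite_list[OF finite_monoms_multideg] by blast
  define Us where "Us = map (\<lambda>t. rc (Poly_Mapping.single t 1)) ts"
  have mono: "Poly_Mapping.single t c \<in> carrier R" if "t \<in> set ts" for t c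
    using that by (auto simp: ts mem_mpoly_ring)
  have Us: "set Us \<subseteq> carrier A"
    using mono by (auto simp: Us_def carrier_A)
  have "rc F \<in> A.Span (rc ` range Const) Us" if F: "F \<in> forms k n j" for F
  proof -
    have "rc (\<Sum>t\<in>S. Poly_Mapping.single t (Poly_Mapping.lookup F t)) \<in> A.Span (rc ` range Const) Us"
      if "finite S" "S \<subseteq> Poly_Mapping.keys F" for S
      using that
    proof (induction S rule: finite_induct)
      case empty
      thus ?case using A.Span_subgroup_props(2)[OF subfield_constants Us] by (simp add: rc_zero)
    next
      case (insert t S)
      let ?c = "Poly_Mapping.lookup F t"
      have sub: "Poly_Mapping.keys F \<subseteq> set ts"
        using F by (auto simp: mem_forms mem_mpoly_ring ts)
      have t: "t \<in> set ts" using insert sub by auto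
      have "rc (Poly_Mapping.single t 1) \<in> A.Span (rc ` range Const) Us"
        using A.Span_base_incl[OF subfield_constants Us] t by (auto simp: Us_def)
      hence "rc (Const ?c) \<otimes>\<^bsub>A\<^esub> rc (Poly_Mapping.single t 1) \<in> A.Span (rc ` range Const) Us"
        using A.Span_smult_closed[OF subfield_constants Us] by blast
      hence "rc (Poly_Mapping.single t ?c) \<in> A.Span (rc ` range Const) Us"
        using mono[OF t] by (simp add: rc_mult mpoly_ring_closed Const_def mult_single
            Const_mem_mpoly_ring[unfolded Const_def])
      hence "rc (Poly_Mapping.single t ?c) \<oplus>\<^bsub>A\<^esub> rc (\<Sum>t\<in>S. Poly_Mapping.single t (Poly_Mapping.lookup F t)) \<in>
          A.Span (rc ` range Const) Us"
        using A.Span_subgroup_props(3)[OF subfield_constants Us] insert by auto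
      moreover have "(\<Sum>t\<in>S. Poly_Mapping.single t (Poly_Mapping.lookup F t)) \<in> carrier R"
        using insert sub mono by (intro mpoly_ring_closed) auto
      ultimately show ?case using insert mono[OF t] by (simp add: rc_add)
    qed
    from this[of "Poly_Mapping.keys F"] show ?thesis by (simp add: mpoly_sum_single[symmetric])
  qed
  hence sub: "rc ` forms k n j \<subseteq> A.Span (rc ` range Const) Us" by blast
  have "subalgebra (rc ` range Const) (rc ` forms k n j) A"
  proof (intro subalgebra.intro subalgebra_axioms.intro)
    show "subgroup (rc ` forms k n j) (add_monoid A)"
    proof (rule A.add.subgroupI)
      show "\<ominus>\<^bsub>A\<^esub> x \<in> rc ` forms k n j" if x: "x \<in> rc ` forms k n j" for x
        using x by (auto simp: rc_uminus forms_in_mpoly_ring forms_uminus)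
      show "x \<oplus>\<^bsub>A\<^esub> y \<in> rc ` forms k n j" if "x \<in> rc ` forms k n j" "y \<in> rc ` forms k n j" for x y
        using that by (auto simp: rc_add forms_in_mpoly_ring forms_add)
      show "rc ` forms k n j \<noteq> {}" using forms_zero by blast
    qed (rule rc_forms_subset)
    show "x \<otimes>\<^bsub>A\<^esub> y \<in> rc ` forms k n j" if "x \<in> rc ` range Const" "y \<in> rc ` forms k n j" for x y
      using that
      by (auto simp: rc_mult forms_in_mpoly_ring mpoly_ring_closed Const_mult_forms)
  qed
  with sub show ?thesis
    using A.subalbegra_incl_imp_finite_dimension[OF subfield_constants
        A.Span_finite_dimension[OF subfield_constants Us]] by blast
qed

lemma dimension_forms:
  "A.dimension (hilbert_function k n \<XX> j) (rc ` range Const) (rc ` forms k n j)"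
  unfolding hilbert_function_def
  by (rule A.dimension_dim[OF subfield_constants finite_dimension_forms])

section \<open>The irrelevant ideal and linear forms avoiding the points\<close>

lemma ideal_irrelevant_ideal: "ideal (irrelevant_ideal k n \<XX>) A"
  unfolding irrelevant_ideal_def
  by (rule A.genideal_ideal) (auto simp: carrier_A mpoly_ring_closed)

lemma rc_Var_mem_irrelevant:
  assumes "v \<in> var_indices k n"
  shows "rc (Var v) \<in> irrelevant_ideal k n \<XX>"
proof -
  have "rc ` Var ` var_indices k n \<subseteq> carrier A"
    by (auto simp: carrier_A mpoly_ring_closed)
  thus ?thesis
    unfolding irrelevant_ideal_def using A.genideal_self assms by blast
qed

text \<open>The form is taken on the moment curve \<open>(1, x, x\<^sup>2, \<dots>)\<close>: each point excludes only finitely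
  many values of \<open>x\<close>.\<close>
lemma ex_linear_form:
  assumes l: "l \<in> {1..k}"
  shows "\<exists>L. L \<in> forms k n (\<lambda>l'. of_bool (l' = l)) \<and> rc L \<in> irrelevant_ideal k n \<XX> \<and>
    (\<forall>P\<in>\<XX>. \<forall>c. c l \<noteq> 0 \<longrightarrow> eval_mpoly (cone_point (rep P) c) L \<noteq> 0)"
proof -
  \<comment> \<open>\<open>poly (p P) x\<close> is the value at the representative of
    \<open>P\<close> of the linear form with coefficients \<open>x ^ m\<close>. Its own coefficients
    are coordinates of \<open>P\<close>, so it is not the zero polynomial.\<close>
  define p where "p = (\<lambda>P. \<Sum>m=0..n l. Polynomial.monom (rep P l m) m)"
  have "p P \<noteq> 0" if P: "P \<in> \<XX>" for P
  proof -
    obtain m where m: "m \<le> n l" "rep P l m \<noteq> 0"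
      using represents_rep[OF P] l unfolding represents_def nonzero_vecs_def by blast
    hence "Polynomial.coeff (p P) m \<noteq> 0" by (simp add: p_def Polynomial.coeff_sum)
    thus ?thesis by auto
  qed
  hence "finite (\<Union>P\<in>\<XX>. {x. poly (p P) x = 0})"
    by (intro finite_UN_I finite_points poly_roots_finite) auto
  then obtain x where x: "\<And>P. P \<in> \<XX> \<Longrightarrow> poly (p P) x \<noteq> 0"
    using ex_new_if_finite[OF infinite_UNIV_char_0] by blast
  define L where "L = (\<Sum>m=0..n l. Const (x ^ m) * Var (l, m))"
  have var: "(l, m) \<in> var_indices k n" if "m \<in> {0..n l}" for m
    using l that by (simp add: var_indices_def)
  have "L \<in> forms k n (\<lambda>l'. of_bool (l' = l))"
    unfolding L_def by (intro forms_sum Const_mult_forms Var_mem_forms var)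
  moreover have "eval_mpoly (cone_point (rep P) c) L = c l * poly (p P) x" for P c
    by (simp add: L_def p_def eval_mpoly_sum eval_mpoly_mult cone_point_def poly_sum poly_monom
        sum_distrib_left mult_ac)
  moreover have "rc L \<in> irrelevant_ideal k n \<XX>"
  proof -
    interpret J: ideal "irrelevant_ideal k n \<XX>" A by (rule ideal_irrelevant_ideal)
    have "rc (\<Sum>m\<in>S. Const (x ^ m) * Var (l, m)) \<in> irrelevant_ideal k n \<XX>"
      if "finite S" "S \<subseteq> {0..n l}" for S
      using that
    proof (induction S rule: finite_induct)
      case empty
      thus ?case using J.zero_closed by (simp add: rc_zero)
    next
      case (insert m S)
      have c: "Const (x ^ m) * Var (l, m) \<in> carrier R" if "m \<in> {0..n l}" for m
        using that by (intro mpoly_ring_closed var)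
      have m: "m \<in> {0..n l}" using insert by auto
      have "rc (Const (x ^ m)) \<otimes>\<^bsub>A\<^esub> rc (Var (l, m)) \<in> irrelevant_ideal k n \<XX>"
        using var[OF m] by (intro J.I_l_closed rc_Var_mem_irrelevant)
          (auto simp: carrier_A mpoly_ring_closed)
      hence "rc (Const (x ^ m) * Var (l, m)) \<oplus>\<^bsub>A\<^esub> rc (\<Sum>m\<in>S. Const (x ^ m) * Var (l, m)) \<in>
          irrelevant_ideal k n \<XX>"
        using insert var[OF m] by (intro J.a_closed) (auto simp: rc_mult mpoly_ring_closed)
      moreover have "(\<Sum>m\<in>S. Const (x ^ m) * Var (l, m)) \<in> carrier R"
        using insert by (intro sum_mem_mpoly_ring c) auto
      ultimately show ?case using insert c[OF m] by (simp add: rc_add)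
    qed
    thus ?thesis by (simp add: L_def)
  qed
  ultimately show ?thesis using x by (intro exI[of _ L]) auto
qed

text \<open>If \<open>L F\<close> vanishes on a cone, then \<open>F\<close> vanishes wherever all
  coefficients are nonzero, because \<open>L\<close> does not vanish there. By density
  \<open>F\<close> vanishes on the whole cone.\<close>

lemma linear_form_nonzerodivisor:
  assumes l: "l \<in> {1..k}" and L: "L \<in> carrier R"
    and nz: "\<And>P c. P \<in> \<XX> \<Longrightarrow> c l \<noteq> 0 \<Longrightarrow> eval_mpoly (cone_point (rep P) c) L \<noteq> 0"
    and a: "a \<in> carrier A" "rc L \<otimes>\<^bsub>A\<^esub> a = \<zero>\<^bsub>A\<^esub>"
  shows "a = \<zero>\<^bsub>A\<^esub>"
proof -
  obtain F where F: "F \<in> carrier R" "a = rc F" using a by (auto simp: carrier_A)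
  have "rc (L * F) = rc 0" using a F L by (simp add: rc_mult rc_zero)
  hence zero: "eval_mpoly (cone_point (rep P) c) L * eval_mpoly (cone_point (rep P) c) F = 0"
    if "P \<in> \<XX>" for P c
    using that F L by (simp add: rc_eq_iff mpoly_ring_closed eval_mpoly_mult)
  have "eval_mpoly (cone_point (rep P) c) F = 0" if P: "P \<in> \<XX>" for P c
  proof (rule cone_vanishing_dense[of k])
    show "eval_mpoly (cone_point (rep P) c) F = 0" if "\<forall>l\<in>{1..k}. c l \<noteq> 0" for c
      using zero[OF P, of c] nz[OF P, of c] that l by simp
  qed
  hence "rc F = rc 0" using F by (simp add: rc_eq_iff mpoly_ring_closed)
  thus ?thesis using F by (simp add: rc_zero)
qed

text \<open>The ideal of the points is homogeneous, since vanishing on the cones passes from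
  \<open>G - F\<close> to its component of multidegree \<open>j\<close>.\<close>

lemma rc_component_eq:
  assumes "G \<in> forms k n j" "F \<in> carrier R" "rc G = rc F"
  shows "rc G = rc (component k n j F)"
proof -
  have G: "G \<in> carrier R" using assms by (simp add: mem_forms)
  have "eval_mpoly (cone_point (rep P) c) (component k n j (G - F)) = 0" if "P \<in> \<XX>" for P c
    by (rule cone_vanishing_component)
      (use assms G that in \<open>auto simp: mpoly_ring_closed rc_eq_iff eval_mpoly_diff\<close>)
  moreover have "component k n j (G - F) = G - component k n j F"
    using component_form[OF assms(1)] by (simp add: component_def mpoly_part_diff)
  ultimately show ?thesis
    using G assms(2) component_mem_forms[OF assms(2), of j]
    by (simp add: rc_eq_iff eval_mpoly_diff mem_forms)
qed

lemma depth_coord_ring: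
  assumes k: "k \<ge> 1" and n: "\<forall>l\<in>{1..k}. n l \<ge> 1" and s: "card \<XX> > 1"
    and generic: "generic_position k n \<XX>"
  shows "depth A (irrelevant_ideal k n \<XX>) = 1"
proof -
  define e :: "nat \<Rightarrow> nat \<Rightarrow> nat" where "e = (\<lambda>l l'. of_bool (l' = l))"
  define H where "H = (\<lambda>j. rc ` forms k n j)"
  have dim: "A.dimension (min (num_monoms k n j) (card \<XX>)) (rc ` range Const) (H j)" for j
    using dimension_forms[of j] generic by (simp add: generic_position_def H_def)
  obtain i where i: "num_monoms k n i < card \<XX>"
    "\<And>l. l \<in> {1..k} \<Longrightarrow> card \<XX> \<le> num_monoms k n (\<lambda>l'. e l l' + i l')"
    using ex_maximal_multidegree[OF s, of k n] n by (auto simp: e_def)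
  have l1: "1 \<in> {1..k}" using k by simp
  obtain L where L: "L \<in> forms k n (e 1)" "rc L \<in> irrelevant_ideal k n \<XX>"
    "\<And>P c. P \<in> \<XX> \<Longrightarrow> c 1 \<noteq> 0 \<Longrightarrow> eval_mpoly (cone_point (rep P) c) L \<noteq> 0"
    using ex_linear_form[OF l1] unfolding e_def by blast
  have LR: "L \<in> carrier R" using L(1) by (simp add: mem_forms)
  have LA: "rc L \<in> carrier A" using LR by (auto simp: carrier_A)
  have nzd: "a = \<zero>\<^bsub>A\<^esub>" if "a \<in> carrier A" "rc L \<otimes>\<^bsub>A\<^esub> a = \<zero>\<^bsub>A\<^esub>" for a
    using linear_form_nonzerodivisor[OF l1 LR L(3) that] .
  have LH: "(\<otimes>\<^bsub>A\<^esub>) (rc L) ` H j \<subseteq> H (\<lambda>l. e 1 l + j l)" for j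
    using forms_mult[OF L(1)] LR by (auto simp: H_def rc_mult forms_in_mpoly_ring)
  have dimL: "A.dimension (min (num_monoms k n j) (card \<XX>)) (rc ` range Const) ((\<otimes>\<^bsub>A\<^esub>) (rc L) ` H j)" for j
    using A.dimension_mult_image[OF subfield_constants dim LA nzd] .
  \<comment> \<open>The left side has dimension \<open>num_monoms k n i < card \<XX>\<close>, the
    right side has dimension \<open>card \<XX>\<close>.\<close>
  have "(\<otimes>\<^bsub>A\<^esub>) (rc L) ` H i \<noteq> H (\<lambda>l. e 1 l + i l)"
  proof
    assume "(\<otimes>\<^bsub>A\<^esub>) (rc L) ` H i = H (\<lambda>l. e 1 l + i l)"
    hence "min (num_monoms k n i) (card \<XX>) = min (num_monoms k n (\<lambda>l. e 1 l + i l)) (card \<XX>)"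
      using A.dimension_is_inj[OF subfield_constants dimL[of i]] dim[of "\<lambda>l. e 1 l + i l"] by simp
    thus False using i(1) i(2)[OF l1] by linarith
  qed
  then obtain G where G: "G \<in> forms k n (\<lambda>l. e 1 l + i l)" "rc G \<notin> (\<otimes>\<^bsub>A\<^esub>) (rc L) ` H i"
    using LH[of i] by (auto simp: H_def)
  have GR: "G \<in> carrier R" using G(1) by (simp add: mem_forms)
  have GA: "rc G \<in> carrier A" using GR by (auto simp: carrier_A)
  \<comment> \<open>\<open>G\<close> was chosen outside \<open>L\<close> times the piece of
    multidegree \<open>i\<close>. A multiple of \<open>L\<close> by any \<open>U\<close> can be
    replaced by the one by the component of \<open>U\<close> of multidegree \<open>i\<close>, so
    \<open>G\<close> lies outside the whole ideal of \<open>L\<close>.\<close>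
  have not_mult: "rc G \<noteq> rc L \<otimes>\<^bsub>A\<^esub> a" if a: "a \<in> carrier A" for a
  proof
    assume eq: "rc G = rc L \<otimes>\<^bsub>A\<^esub> a"
    obtain U where U: "U \<in> carrier R" "a = rc U" using a by (auto simp: carrier_A)
    have "rc G = rc (component k n (\<lambda>l. e 1 l + i l) (L * U))"
      by (rule rc_component_eq[OF G(1)]) (use eq U LR in \<open>auto simp: rc_mult mpoly_ring_closed\<close>)
    also have "\<dots> = rc L \<otimes>\<^bsub>A\<^esub> rc (component k n i U)"
      using component_mult_form[OF L(1) U(1)] LR component_mem_forms[OF U(1), of i]
      by (simp add: rc_mult mem_forms)
    finally show False using G(2) component_mem_forms[OF U(1), of i] by (auto simp: H_def)
  qed
  have socle: "\<exists>a\<in>carrier A. x \<otimes>\<^bsub>A\<^esub> rc G = rc L \<otimes>\<^bsub>A\<^esub> a" if "x \<in> irrelevant_ideal k n \<XX>" for x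
  proof -
    \<comment> \<open>The colon ideal of \<open>G\<close> into the ideal of \<open>L\<close>; it
      suffices that it contains the variables.\<close>
    let ?I = "{x \<in> carrier A. rc G \<otimes>\<^bsub>A\<^esub> x \<in> Idl\<^bsub>A\<^esub> {rc L}}"
    have I: "ideal ?I A"
      using LA by (intro ideal.helper_max_prime A.genideal_ideal A.is_cring GA) auto
    have "rc (Var (l, m)) \<in> ?I" if v: "(l, m) \<in> var_indices k n" for l m
    proof -
      have l: "l \<in> {1..k}" using v by (auto simp: var_indices_def)
      define j where "j = (\<lambda>l'. e l l' + i l')"
      \<comment> \<open>\<open>Var (l, m) * G\<close> has multidegree \<open>e l + e 1 + i\<close>,
        which is also the multidegree of \<open>L\<close> times a form of multidegree
        \<open>j = e l + i\<close>.\<close>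
      have eq: "(\<lambda>l'. e l l' + (e 1 l' + i l')) = (\<lambda>l'. e 1 l' + j l')" by (auto simp: j_def)
      have "card \<XX> \<le> num_monoms k n j" using i(2)[OF l] by (simp add: j_def)
      moreover have "num_monoms k n j < num_monoms k n (\<lambda>l'. e 1 l' + j l')"
        unfolding e_def using l1 n by (intro num_monoms_less) auto
      \<comment> \<open>Both pieces have dimension \<open>card \<XX>\<close>, so the inclusion
        \<open>LH\<close> is an equality.\<close>
      ultimately have "(\<otimes>\<^bsub>A\<^esub>) (rc L) ` H j = H (\<lambda>l'. e 1 l' + j l')"
        using A.dimension_subset_eq[OF subfield_constants dimL[of j] _ LH]
          dim[of "\<lambda>l'. e 1 l' + j l'"] by (simp add: min_def)
      moreover have "Var (l, m) * G \<in> forms k n (\<lambda>l'. e 1 l' + j l')"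
        using forms_mult[OF Var_mem_forms[OF v] G(1)] unfolding eq[symmetric] by (simp add: e_def)
      ultimately have "rc (Var (l, m) * G) \<in> (\<otimes>\<^bsub>A\<^esub>) (rc L) ` H j" by (auto simp: H_def)
      moreover have "H j \<subseteq> carrier A" unfolding H_def by (rule rc_forms_subset)
      ultimately have "rc (Var (l, m) * G) \<in> Idl\<^bsub>A\<^esub> {rc L}"
        using LA by (auto simp: A.mem_genideal_singleton)
      thus ?thesis using v GR
        by (simp add: rc_mult mpoly_ring_closed carrier_A mult.commute)
    qed
    hence "rc ` Var ` var_indices k n \<subseteq> ?I" by auto
    hence "irrelevant_ideal k n \<XX> \<subseteq> ?I"
      unfolding irrelevant_ideal_def by (rule A.genideal_minimal[OF I])
    hence "x \<in> ?I" using that by blast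
    thus ?thesis using LA GA by (auto simp: A.mem_genideal_singleton A.m_comm)
  qed
  show ?thesis
    by (rule A.depth_eq_one[OF ideal_irrelevant_ideal L(2) nzd GA not_mult socle])
qed

end

section \<open>Chains of prime ideals\<close>

context point_set
begin

text \<open>On the line joining a point where \<open>F\<close> is nonzero to a point where \<open>G\<close> is nonzero, both
  restrict to nonzero polynomials in one variable.\<close>
lemma primeideal_vanishing:
  assumes P: "P \<in> \<XX>" and C: "C \<noteq> {}"
    and line: "\<And>c d x. c \<in> C \<Longrightarrow> d \<in> C \<Longrightarrow> (\<lambda>l. c l + x * (d l - c l)) \<in> C"
  defines "Q \<equiv> {F \<in> carrier R. \<forall>c\<in>C. eval_mpoly (cone_point (rep P) c) F = 0}"
  shows "primeideal (rc ` Q) A"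
proof (rule primeidealI2)
  \<comment> \<open>\<open>P\<close> is one of the points, so \<open>Q\<close> contains their ideal,
    and membership in the image can be tested on any representative.\<close>
  have mem: "rc F \<in> rc ` Q \<longleftrightarrow> F \<in> Q" if F: "F \<in> carrier R" for F
  proof
    assume "rc F \<in> rc ` Q"
    then obtain G where G: "G \<in> Q" "rc F = rc G" by blast
    hence "G \<in> carrier R" by (simp add: Q_def)
    with G F P show "F \<in> Q" by (simp add: Q_def rc_eq_iff)
  qed auto
  show "cring A" by (rule A.is_cring)
  show "additive_subgroup (rc ` Q) A"
  proof (intro additive_subgroupI A.add.subgroupI)
    show "rc ` Q \<subseteq> carrier A" by (auto simp: Q_def carrier_A)
    have "0 \<in> Q" by (simp add: Q_def mpoly_ring_closed)
    thus "rc ` Q \<noteq> {}" by blast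
    show "\<ominus>\<^bsub>A\<^esub> x \<in> rc ` Q" if "x \<in> rc ` Q" for x
      using that by (auto simp: Q_def rc_uminus mpoly_ring_closed eval_mpoly_uminus)
    show "x \<oplus>\<^bsub>A\<^esub> y \<in> rc ` Q" if "x \<in> rc ` Q" "y \<in> rc ` Q" for x y
      using that by (auto simp: Q_def rc_add mpoly_ring_closed eval_mpoly_add)
  qed
  show "x \<otimes>\<^bsub>A\<^esub> a \<in> rc ` Q" if "a \<in> rc ` Q" "x \<in> carrier A" for a x
    using that by (auto simp: Q_def carrier_A rc_mult mpoly_ring_closed eval_mpoly_mult)
  show "a \<otimes>\<^bsub>A\<^esub> x \<in> rc ` Q" if "a \<in> rc ` Q" "x \<in> carrier A" for a x
    using that by (auto simp: Q_def carrier_A rc_mult mpoly_ring_closed eval_mpoly_mult)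
  have "rc 1 \<notin> rc ` Q" using C by (auto simp: mem mpoly_ring_closed) (auto simp: Q_def)
  moreover have "rc 1 \<in> carrier A" by (auto simp: carrier_A mpoly_ring_closed)
  ultimately show "carrier A \<noteq> rc ` Q" by blast
  show "a \<in> rc ` Q \<or> b \<in> rc ` Q"
    if ab: "a \<in> carrier A" "b \<in> carrier A" "a \<otimes>\<^bsub>A\<^esub> b \<in> rc ` Q" for a b
  proof (rule ccontr)
    assume neg: "\<not> (a \<in> rc ` Q \<or> b \<in> rc ` Q)"
    obtain F G where FG: "F \<in> carrier R" "a = rc F" "G \<in> carrier R" "b = rc G"
      using ab by (auto simp: carrier_A)
    obtain c d where c: "c \<in> C" "eval_mpoly (cone_point (rep P) c) F \<noteq> 0"
      and d: "d \<in> C" "eval_mpoly (cone_point (rep P) d) G \<noteq> 0"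
      using neg FG mem by (auto simp: Q_def)
    obtain p where p: "\<And>x. poly p x = eval_mpoly (cone_point (rep P) (\<lambda>l. c l + x * (d l - c l))) F"
      using eval_cone_line by blast
    obtain q where q: "\<And>x. poly q x = eval_mpoly (cone_point (rep P) (\<lambda>l. c l + x * (d l - c l))) G"
      using eval_cone_line by blast
    have "F * G \<in> Q" using ab FG mem by (simp add: rc_mult mpoly_ring_closed)
    hence "poly (p * q) x = 0" for x
      using line[OF c(1) d(1)] by (simp add: p q Q_def eval_mpoly_mult)
    hence "p * q = 0" by (intro poly_eq_0_cofinite[of "{}"]) auto
    \<comment> \<open>The line passes through \<open>c\<close> at \<open>x = 0\<close> and through
      \<open>d\<close> at \<open>x = 1\<close>.\<close>
    moreover have "poly p 0 \<noteq> 0" using c by (simp add: p)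
    moreover have "poly q 1 \<noteq> 0" using d by (simp add: q)
    ultimately show False by auto
  qed
qed

section \<open>Lower bound for the Krull dimension\<close>

lemma krull_dim_ge: "enat k \<le> krull_dim A"
proof -
  obtain P where P: "P \<in> \<XX>" using nonempty by blast
  \<comment> \<open>\<open>C i\<close> leaves the blocks \<open>1\<close> to \<open>k - i\<close>
    free and kills the later ones; the value at index 0 affects no variable. So \<open>Q 0\<close>
    belongs to the whole cone over \<open>P\<close> and \<open>Q k\<close> to its vertex.\<close>
  define C :: "nat \<Rightarrow> (nat \<Rightarrow> 'a) set" where "C = (\<lambda>i. {c. \<forall>l>k - i. c l = 0})"
  define Q where "Q = (\<lambda>i. {F \<in> carrier R. \<forall>c\<in>C i. eval_mpoly (cone_point (rep P) c) F = 0})"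
  have "primeideal (rc ` Q i) A" for i
    unfolding Q_def by (rule primeideal_vanishing[OF P]) (auto simp: C_def)
  moreover have "rc ` Q i \<subset> rc ` Q (Suc i)" if i: "i < k" for i
  proof
    have "C (Suc i) \<subseteq> C i" by (auto simp: C_def)
    thus "rc ` Q i \<subseteq> rc ` Q (Suc i)" by (auto simp: Q_def)
    have l: "k - i \<in> {1..k}" using i by auto
    obtain m where m: "m \<le> n (k - i)" "rep P (k - i) m \<noteq> 0"
      using represents_rep[OF P] l unfolding represents_def nonzero_vecs_def by blast
    have v: "(k - i, m) \<in> var_indices k n" using l m by (simp add: var_indices_def)
    \<comment> \<open>This variable separates the two primes: block \<open>k - i\<close> is killed
      in \<open>C (Suc i)\<close>, while the unit vector of that block lies in \<open>C i\<close>
      and the coordinate \<open>m\<close> of \<open>P\<close> there is nonzero.\<close>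
    have "Var (k - i, m) \<in> Q (Suc i)"
      using v i by (auto simp: Q_def mpoly_ring_closed cone_point_def C_def)
    moreover have "rc (Var (k - i, m)) \<notin> rc ` Q i"
    proof
      assume "rc (Var (k - i, m)) \<in> rc ` Q i"
      then obtain G where G: "G \<in> carrier R" "rc (Var (k - i, m)) = rc G"
        "\<And>c. c \<in> C i \<Longrightarrow> eval_mpoly (cone_point (rep P) c) G = 0" by (auto simp: Q_def)
      have "(\<lambda>l. of_bool (l = k - i)) \<in> C i" by (auto simp: C_def)
      from G(3)[OF this] have "cone_point (rep P) (\<lambda>l. of_bool (l = k - i)) (k - i, m) = 0"
        using G(1,2) P v by (simp add: rc_eq_iff mpoly_ring_closed)
      thus False using m by (simp add: cone_point_def)
    qed
    ultimately show "rc ` Q i \<noteq> rc ` Q (Suc i)" by blast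
  qed
  ultimately have "enat k \<in> {enat r | r. \<exists>P :: nat \<Rightarrow> 'a mpoly set set.
     (\<forall>i\<le>r. primeideal (P i) A) \<and> (\<forall>i<r. P i \<subset> P (Suc i))}"
    by (intro CollectI exI[of _ k] conjI exI[of _ "\<lambda>i. rc ` Q i"]) auto
  thus ?thesis unfolding krull_dim_def by (rule Sup_upper)
qed

section \<open>Upper bound for the Krull dimension when k = 1\<close>

text \<open>Multisets accommodate repeated linear factors as well as products over the set of
  points.\<close>

lemma prime_prod_mset:
  assumes p: "primeideal p A"
    and "\<And>x. x \<in># M \<Longrightarrow> f x \<in> carrier R" "rc (\<Prod>x\<in>#M. f x) \<in> p"
  shows "\<exists>x\<in>#M. rc (f x) \<in> p"
proof -
  interpret p: primeideal p A by (rule p)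
  have "rc 1 \<notin> p"
    using p.I_notcarr p.one_imp_carrier by (auto simp: rc_one)
  have *: "(\<Prod>x\<in>#M. f x) \<in> carrier R" if "\<And>x. x \<in># M \<Longrightarrow> f x \<in> carrier R" for M
    using that by (induction M) (auto simp: mpoly_ring_closed)
  show ?thesis
    using assms(2,3)
  proof (induction M)
    case empty
    thus ?case using \<open>rc 1 \<notin> p\<close> by simp
  next
    case (add x M)
    have "rc (f x) \<otimes>\<^bsub>A\<^esub> rc (\<Prod>x\<in>#M. f x) \<in> p"
      using add.prems *[of M] by (simp add: rc_mult)
    hence "rc (f x) \<in> p \<or> rc (\<Prod>x\<in>#M. f x) \<in> p"
      using add.prems *[of M] by (intro p.I_prime) (auto simp: carrier_A)
    thus ?case using add by auto
  qed
qed

text \<open>Otherwise choose for each point a polynomial outside \<open>p\<close> vanishing on its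
  cone. The product vanishes on all the cones, so its class is 0 and lies in \<open>p\<close>, and
  primality puts one factor into \<open>p\<close>.\<close>

lemma prime_contains_point:
  assumes p: "primeideal p A"
  shows "\<exists>P\<in>\<XX>. \<forall>F\<in>carrier R. (\<forall>c. eval_mpoly (cone_point (rep P) c) F = 0) \<longrightarrow> rc F \<in> p"
proof (rule ccontr)
  assume "\<not> ?thesis"
  hence "\<forall>P\<in>\<XX>. \<exists>F. F \<in> carrier R \<and> (\<forall>c. eval_mpoly (cone_point (rep P) c) F = 0) \<and> rc F \<notin> p"
    by blast
  then obtain f where f: "\<And>P. P \<in> \<XX> \<Longrightarrow> f P \<in> carrier R" "\<And>P. P \<in> \<XX> \<Longrightarrow> rc (f P) \<notin> p"
    "\<And>P c. P \<in> \<XX> \<Longrightarrow> eval_mpoly (cone_point (rep P) c) (f P) = 0" by metis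
  have "eval_mpoly (cone_point (rep P) c) (\<Prod>P\<in>\<XX>. f P) = 0" if "P \<in> \<XX>" for P c
    using that f(3) finite_points unfolding eval_mpoly_prod by (intro prod_zero) auto
  hence "rc (\<Prod>P\<in>\<XX>. f P) = rc 0"
    using f(1) by (subst rc_eq_iff) (auto simp: mpoly_ring_closed)
  moreover have "\<zero>\<^bsub>A\<^esub> \<in> p"
    using p by (auto simp: primeideal_def ideal_def intro: additive_subgroup.zero_closed)
  ultimately have "rc (\<Prod>P\<in>#mset_set \<XX>. f P) \<in> p"
    by (simp add: rc_zero prod_unfold_prod_mset)
  thus False using prime_prod_mset[OF p, of "mset_set \<XX>" f] f(1,2) finite_points by auto
qed

text \<open>For \<open>k = 1\<close> the cone is a line with coordinate \<open>c 1\<close>. The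
  restriction of \<open>F\<close> is a nonzero univariate polynomial, which splits over an
  algebraically closed field; \<open>e\<close> is its leading coefficient and \<open>M\<close> its
  multiset of roots.\<close>

lemma eval_cone_factorization:
  assumes k: "k = 1" and F: "F \<in> carrier R" and nz: "eval_mpoly (cone_point u d) F \<noteq> 0"
  shows "\<exists>e M. e \<noteq> 0 \<and> (\<forall>c. eval_mpoly (cone_point u c) F = e * (\<Prod>a\<in>#M. c 1 - a))"
proof -
  obtain p where p: "\<And>x. poly p x = eval_mpoly (cone_point u (\<lambda>l. 0 + x * (1 - 0))) F"
    using eval_cone_line[of u "\<lambda>_. 0" "\<lambda>_. 1" F] by auto
  have eval: "eval_mpoly (cone_point u c) F = poly p (c 1)" for c
    unfolding p by (rule eval_mpoly_cong[OF F]) (auto simp: k var_indices_def cone_point_def)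
  have "p \<noteq> 0" using nz eval by auto
  then obtain M where "p = Polynomial.smult (lead_coeff p) (\<Prod>a\<in>#M. [:-a, 1:])"
    using alg_closed_imp_factorization by blast
  hence "poly p x = lead_coeff p * poly (\<Prod>a\<in>#M. [:-a, 1:]) x" for x
    by (metis poly_smult)
  hence "poly p x = lead_coeff p * (\<Prod>a\<in>#M. x - a)" for x
    by (simp add: poly_prod_mset image_mset.compositionality o_def)
  thus ?thesis using \<open>p \<noteq> 0\<close> by (intro exI[of _ "lead_coeff p"] exI[of _ M]) (auto simp: eval)
qed

text \<open>A prime ideal contains the ideal \<open>I\<close> of some point, and for \<open>k = 1\<close> the ring \<open>R/I\<close> is a
  polynomial ring in the coordinate \<open>y\<close> along the line over that point. A prime strictly above
  one that contains \<open>I\<close> contains some \<open>y - a\<close>, hence is maximal.\<close>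
lemma no_prime_chain:
  assumes k: "k = 1" and p0: "primeideal p0 A" and p1: "primeideal p1 A" and p2: "primeideal p2 A"
    and strict: "p0 \<subset> p1" "p1 \<subset> p2"
  shows False
proof -
  interpret p0: primeideal p0 A by (rule p0)
  interpret p1: primeideal p1 A by (rule p1)
  interpret p2: primeideal p2 A by (rule p2)
  obtain P where P: "P \<in> \<XX>"
    and Pp0: "\<And>F. F \<in> carrier R \<Longrightarrow> (\<And>c. eval_mpoly (cone_point (rep P) c) F = 0) \<Longrightarrow> rc F \<in> p0"
    using prime_contains_point[OF p0] by blast
  have "\<exists>m\<le>n 1. rep P 1 m \<noteq> 0"
    using represents_rep[OF P] k unfolding represents_def nonzero_vecs_def by auto
  then obtain m where m: "m \<le> n 1" "rep P 1 m \<noteq> 0" by blast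
  \<comment> \<open>Dividing by a nonzero coordinate of \<open>P\<close> makes the value of
    \<open>y\<close> on the cone equal to the parameter \<open>c 1\<close>.\<close>
  define y :: "'a mpoly" where "y = Const (inverse (rep P 1 m)) * Var (1, m)"
  have y: "y \<in> carrier R" using m k by (simp add: y_def mpoly_ring_closed var_indices_def)
  have eval_y: "eval_mpoly (cone_point (rep P) c) y = c 1" for c
    using m by (simp add: y_def eval_mpoly_mult cone_point_def)
  define lin where "lin = (\<lambda>a. y - Const a)"
  have lin: "lin a \<in> carrier R" "eval_mpoly (cone_point (rep P) c) (lin a) = c 1 - a" for a c
    using y by (auto simp: lin_def mpoly_ring_closed eval_y eval_mpoly_diff)
  have lins: "(\<Prod>a\<in>#M. lin a) \<in> carrier R"
    "eval_mpoly (cone_point (rep P) c) (\<Prod>a\<in>#M. lin a) = (\<Prod>a\<in>#M. c 1 - a)" for M c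
    using lin by (induction M) (auto simp: mpoly_ring_closed eval_mpoly_mult)
  \<comment> \<open>\<open>p1\<close> contains \<open>p0\<close>, which contains the ideal of
    \<open>P\<close>, so membership in \<open>p1\<close> depends only on the restriction to the
    line.\<close>
  have congr: "rc F \<in> p1 \<longleftrightarrow> rc G \<in> p1"
    if FG: "F \<in> carrier R" "G \<in> carrier R"
      "\<And>c. eval_mpoly (cone_point (rep P) c) F = eval_mpoly (cone_point (rep P) c) G" for F G
  proof -
    have *: "rc F \<in> p1" if FG: "F \<in> carrier R" "G \<in> carrier R" "rc G \<in> p1"
      "\<And>c. eval_mpoly (cone_point (rep P) c) F = eval_mpoly (cone_point (rep P) c) G" for F G
    proof -
      have "rc (F - G) \<in> p0"
        using FG by (intro Pp0) (auto simp: mpoly_ring_closed eval_mpoly_diff)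
      hence "rc (F - G) \<oplus>\<^bsub>A\<^esub> rc G \<in> p1" using strict FG by (intro p1.a_closed) auto
      thus ?thesis using FG by (simp add: rc_add mpoly_ring_closed)
    qed
    show ?thesis using *[of F G] *[of G F] FG by auto
  qed
  \<comment> \<open>Nonzero constants are units.\<close>
  have const: "rc (Const e) \<notin> p" if "e \<noteq> 0" "primeideal p A" for e p
  proof
    interpret p: primeideal p A by (rule that)
    assume "rc (Const e) \<in> p"
    hence "rc (Const (inverse e)) \<otimes>\<^bsub>A\<^esub> rc (Const e) \<in> p"
      by (intro p.I_l_closed) (auto simp: carrier_A mpoly_ring_closed)
    moreover have "Const (inverse e) * Const e = (1 :: 'a mpoly)"
      using that by (simp add: Const_def mult_single)
    ultimately have "\<one>\<^bsub>A\<^esub> \<in> p" by (simp add: rc_mult mpoly_ring_closed rc_one)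
    thus False using p.I_notcarr p.one_imp_carrier by simp
  qed
  obtain F where F: "F \<in> carrier R" "rc F \<in> p1" "rc F \<notin> p0"
    using strict(1) p1.a_subset by (auto simp: carrier_A)
  \<comment> \<open>\<open>F\<close> is nonzero somewhere on the line, since otherwise its class
    would lie in \<open>p0\<close>. By primality one of its linear factors then lies in
    \<open>p1\<close>.\<close>
  obtain d where "eval_mpoly (cone_point (rep P) d) F \<noteq> 0" using F Pp0 by blast
  then obtain e M where eM: "e \<noteq> 0"
    "\<And>c. eval_mpoly (cone_point (rep P) c) F = e * (\<Prod>a\<in>#M. c 1 - a)"
    using eval_cone_factorization[OF k F(1)] by blast
  have "rc (Const e * (\<Prod>a\<in>#M. lin a)) \<in> p1"
    using congr[of F "Const e * (\<Prod>a\<in>#M. lin a)"] F lins eM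
    by (simp add: mpoly_ring_closed eval_mpoly_mult)
  hence "rc (Const e) \<otimes>\<^bsub>A\<^esub> rc (\<Prod>a\<in>#M. lin a) \<in> p1"
    using lins by (simp add: rc_mult mpoly_ring_closed)
  hence "rc (\<Prod>a\<in>#M. lin a) \<in> p1"
    using p1.I_prime[of "rc (Const e)" "rc (\<Prod>a\<in>#M. lin a)"] const[OF eM(1) p1] lins
    by (auto simp: carrier_A mpoly_ring_closed)
  then obtain a where a: "rc (lin a) \<in> p1"
    using prime_prod_mset[OF p1, of M lin] lin by blast
  \<comment> \<open>\<open>p1\<close> contains every function vanishing at the parameter
    \<open>a\<close>: on the line it is either zero or divisible by \<open>lin a\<close>.\<close>
  have max: "rc H \<in> p1" if H: "H \<in> carrier R" "eval_mpoly (cone_point (rep P) (\<lambda>_. a)) H = 0" for H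
  proof (cases "\<forall>c. eval_mpoly (cone_point (rep P) c) H = 0")
    case True
    thus ?thesis using Pp0 H strict by blast
  next
    case False
    then obtain e M where eM: "e \<noteq> 0"
      "\<And>c. eval_mpoly (cone_point (rep P) c) H = e * (\<Prod>a\<in>#M. c 1 - a)"
      using eval_cone_factorization[OF k H(1)] by blast
    have "a \<in># M" using H(2) eM by auto
    then obtain M' where M': "M = add_mset a M'" by (blast dest: multi_member_split)
    have "rc (Const e * (\<Prod>a\<in>#M'. lin a)) \<otimes>\<^bsub>A\<^esub> rc (lin a) \<in> p1"
      using a lins by (intro p1.I_l_closed) (auto simp: carrier_A mpoly_ring_closed)
    hence "rc (Const e * (\<Prod>a\<in>#M'. lin a) * lin a) \<in> p1"
      using lins lin by (simp add: rc_mult mpoly_ring_closed)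
    thus ?thesis
      using congr[of H "Const e * (\<Prod>a\<in>#M'. lin a) * lin a"] H lins lin eM M'
      by (simp add: mpoly_ring_closed eval_mpoly_mult mult_ac)
  qed
  obtain G where G: "G \<in> carrier R" "rc G \<in> p2" "rc G \<notin> p1"
    using strict(2) p2.a_subset by (auto simp: carrier_A)
  define b where "b = eval_mpoly (cone_point (rep P) (\<lambda>_. a)) G"
  have "b \<noteq> 0" using max G by (auto simp: b_def)
  \<comment> \<open>\<open>G\<close> agrees with its value \<open>b\<close> at the parameter
    \<open>a\<close>, so \<open>p2\<close> would contain the unit \<open>b\<close>.\<close>
  have "rc (Const b - G) \<in> p1"
    using G by (intro max) (auto simp: b_def mpoly_ring_closed eval_mpoly_diff)
  hence "rc (Const b - G) \<oplus>\<^bsub>A\<^esub> rc G \<in> p2" using G strict by (intro p2.a_closed) auto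
  hence "rc (Const b) \<in> p2" using G by (simp add: rc_add mpoly_ring_closed)
  thus False using const[OF \<open>b \<noteq> 0\<close> p2] by blast
qed

lemma krull_dim_le_one:
  assumes k: "k = 1"
  shows "krull_dim A \<le> 1"
  unfolding krull_dim_def
proof (rule Sup_least, clarify)
  fix r and P :: "nat \<Rightarrow> 'a mpoly set set"
  assume P: "\<forall>i\<le>r. primeideal (P i) A" "\<forall>i<r. P i \<subset> P (Suc i)"
  have "r \<le> 1"
  proof (rule ccontr)
    assume "\<not> r \<le> 1"
    thus False using no_prime_chain[OF k, of "P 0" "P 1" "P 2"] P by (auto simp: numeral_2_eq_2)
  qed
  thus "enat r \<le> 1" by (simp add: one_enat_def)
qed

end

theorem theorem3p4:
  fixes k s :: nat
    and n :: "nat \<Rightarrow> nat"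
    and \<XX> :: "(nat \<Rightarrow> (nat \<Rightarrow> 'a::{alg_closed_field, field_char_0}) set) set"
  assumes "k \<ge> 1"
    and "\<forall>l\<in>{1..k}. n l \<ge> 1"
    and "\<XX> \<subseteq> multiproj_space k n"
    and "finite \<XX>"
    and "card \<XX> = s"
    and "s > 1"
    and "generic_position k n \<XX>"
  shows "depth (coord_ring k n \<XX>) (irrelevant_ideal k n \<XX>) = 1 \<and>
    (cohen_macaulay (coord_ring k n \<XX>) (irrelevant_ideal k n \<XX>) \<longleftrightarrow> k = 1)"
proof -
  have "\<XX> \<noteq> {}" using assms(5,6) by auto
  then interpret point_set k n \<XX>
    using assms(3,4) by unfold_locales
  have depth: "depth A (irrelevant_ideal k n \<XX>) = 1"
    using assms by (intro depth_coord_ring) auto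
  \<comment> \<open>As the depth is 1, being Cohen-Macaulay means having Krull dimension 1.\<close>
  have "1 = krull_dim A \<longleftrightarrow> k = 1"
  proof
    assume "1 = krull_dim A"
    hence "enat k \<le> 1" using krull_dim_ge by simp
    thus "k = 1" using assms(1) by (simp add: one_enat_def)
  next
    assume k: "k = 1"
    have "1 \<le> krull_dim A" using krull_dim_ge k by (simp add: one_enat_def)
    with krull_dim_le_one[OF k] show "1 = krull_dim A" by simp
  qed
  with depth show ?thesis by (simp add: cohen_macaulay_def)
qed

end
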